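(* Let $d\geq 2$, let $(X_n)_{n\in\mathbb{N}}$ be a sequence of $\mathbb{Z}^d$-valued random variables with laws $\mu_n$, mod-$\phi$ convergent with parameters $\lambda_n\to+\infty$, and let $(\nu_n)_{n\in\mathbb{N}}$ be a general approximation scheme, with $\widehat{\mu_n}=e^{\lambda_n\phi}\psi_n$, $\widehat{\nu_n}=e^{\lambda_n\phi}\chi_n$, $\psi_n\to\psi$, $\chi_n\to\chi$. Let $r\geq 0$ be an integer and assume that $$\psi_n(\xi)-\chi_n(\xi)=\sum_{|\alpha|=r+1}\beta_n^{\alpha}\,(i\xi_1)^{\alpha_1}\cdots(i\xi_d)^{\alpha_d}\,(1+o_\xi(1))\quad\text{for all }n\in\mathbb{N},$$ $$\psi(\xi)-\chi(\xi)=\sum_{|\alpha|=r+1}\beta^{\alpha}\,(i\xi_1)^{\alpha_1}\cdots(i\xi_d)^{\alpha_d}\,(1+o_\xi(1)),$$ where the $o_\xi(1)$ tend to $0$ as $\xi\to0$ uniformly in $n$, and $\lim_{n\to\infty}\beta_n^\alpha=\beta^\alpha$ for every multi-index $\alpha\in\mathbb{N}^d$ with $|\alpha|=r+1$. Then, as $n\to\infty$, $$d_{\mathrm L}(\mu_n,\nu_n)=\sup_{x\in\mathbb{R}^d}\left(e^{-\frac{\|x\|^2}{2}}\left|\sum_{|\alpha|=r+1}\frac{\beta^\alpha H_\alpha(x)}{\sigma^\alpha}\right|\right)\times\frac{1}{\big(\prod_{i=1}^d\sqrt{2\pi}\,\sigma_i\big)(\lambda_n)^{\frac{r+d+1}{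2}}}+o\!\left(\frac{1}{(\lambda_n)^{\frac{r+d+1}{2}}}\right).$$
   Context: Fourier transforms: for a (finite signed) measure $\mu$ on $\mathbb{Z}^d$, $\widehat\mu(\xi)=\sum_{k\in\mathbb{Z}^d}\mu(\{k\})e^{i\sum_j k_j\xi_j}$, a function on $\mathbb{T}^d=(\mathbb{R}/2\pi\mathbb{Z})^d$. Reference law: $\phi(\xi)=\sum_{j=1}^d\phi_j(\xi_j)$, where each $\phi_j$ is the ($2\pi$-periodic, continuous, $\phi_j(0)=0$) exponent of an infinitely divisible probability law on $\mathbb{Z}$ with Fourier transform $e^{\phi_j}$, having a second moment and not supported on any proper sublattice of $\mathbb{Z}$. Near $0$, $\phi_j(\theta)=im_j\theta-\frac{\sigma_j^2\theta^2}{2}+o(\theta^2)$ with $\sigma_j>0$. General approximation scheme: $\mu_n$ is the law of $X_n$, $\nu_n$ is a signed measure on $\mathbb{Z}^d$, and $\widehat{\mu_n}=e^{\lambda_n\phi}\psi_n$, $\widehat{\nu_n}=e^{\lambda_n\phi}\chi_n$ with $\lambda_n\to+\infty$, $\psi_n\to\psi$ and $\chi_n\to\chi$ uniformly on $\mathbb{T}^d$. The residues $\psi_n,\psi,\chi_n,\chi$ are functions on $\mathbb{T}^d$ with absolutely convergent Fourier series, and $\chi_n(0)=\chi(0)=1$. Mod-$\phi$ convergence of $(X_n)$ with parameters $\lambda_n$ and limit $\psi$ means precisely this property of $\widehat{\mu_n}$. Local distance: $d_{\mathrm L}(\mu,\nu)=\sup_{k\in\mathbb{Z}^d}|\mu(\{k\})-\nu(\{k\})|$.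 Notation: $|\alpha|=\sum_i\alpha_i$, $\|x\|^2=\sum_i x_i^2$, $\sigma^\alpha=\prod_i\sigma_i^{\alpha_i}$, $H_\alpha(x)=\prod_{i=1}^dH_{\alpha_i}(x_i)$, where $H_r(x)=(-1)^re^{x^2/2}\frac{d^r}{dx^r}e^{-x^2/2}$ is the $r$-th Hermite polynomial. *)

theory Defs
  imports "HOL-Probability.Probability" "HOL-Library.Landau_Symbols"
begin

text \<open>
  A finite signed measure on the discrete set \<open>\<int>\<^sup>d\<close> is represented by the absolutely summable
  family of its point masses; a function on the torus by the corresponding function on
  \<open>\<real>\<^sup>d\<close> that is \<open>2\<pi>\<close>-periodic in each coordinate.
\<close>

definition law_mass :: "'a measure \<Rightarrow> ('a \<Rightarrow> int ^ 'd) \<Rightarrow> int ^ 'd \<Rightarrow> real" where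
  "law_mass M X k = measure (distr M (count_space UNIV) X) {k}"

definition fourier_series :: "(int ^ 'd \<Rightarrow> complex) \<Rightarrow> real ^ 'd \<Rightarrow> complex" where
  "fourier_series c \<xi> =
     (\<Sum>\<^sub>\<infinity>k. c k * exp (\<i> * complex_of_real (\<Sum>j\<in>UNIV. of_int (k $ j) * \<xi> $ j)))"

definition fourier_transform :: "(int ^ 'd \<Rightarrow> real) \<Rightarrow> real ^ 'd \<Rightarrow> complex" where
  "fourier_transform m = fourier_series (\<lambda>k. complex_of_real (m k))"

definition wiener_algebra :: "(real ^ 'd \<Rightarrow> complex) set" where
  "wiener_algebra = {f. \<exists>c. (\<lambda>k. norm (c k)) summable_on UNIV \<and> f = fourier_series c}"

definition local_distance :: "(int ^ 'd \<Rightarrow> real) \<Rightarrow> (int ^ 'd \<Rightarrow> real) \<Rightarrow> real" where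
  "local_distance m m' = (SUP k. \<bar>m k - m' k\<bar>)"

text \<open>\<open>map_pmf sum_list (replicate_pmf n q)\<close> is the \<open>n\<close>-th convolution power of \<open>q\<close>.\<close>

definition infinitely_divisible :: "int pmf \<Rightarrow> bool" where
  "infinitely_divisible p \<longleftrightarrow> (\<forall>n\<ge>1. \<exists>q. p = map_pmf sum_list (replicate_pmf n q))"

text \<open>
  The sublattices of \<open>\<int>\<close> are the subgroups \<open>a\<int>\<close> with \<open>a :: nat\<close>, proper iff \<open>a \<noteq> 1\<close>.
  The last two conjuncts determine \<open>m\<close> and \<open>\<sigma>\<close> from \<open>f\<close>.
\<close>

definition reference_exponent :: "int pmf \<Rightarrow> (real \<Rightarrow> complex) \<Rightarrow> real \<Rightarrow> real \<Rightarrow> bool" where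
  "reference_exponent p f m \<sigma> \<longleftrightarrow>
     infinitely_divisible p \<and>
     integrable (measure_pmf p) (\<lambda>k. (real_of_int k)\<^sup>2) \<and>
     (\<forall>a::nat. a \<noteq> 1 \<longrightarrow> \<not> set_pmf p \<subseteq> range ((*) (int a))) \<and>
     (\<forall>\<theta>. f (\<theta> + 2 * pi) = f \<theta>) \<and> continuous_on UNIV f \<and> f 0 = 0 \<and>
     (\<forall>\<theta>. char (distr (measure_pmf p) borel real_of_int) \<theta> = exp (f \<theta>)) \<and>
     \<sigma> > 0 \<and>
     (\<lambda>\<theta>. f \<theta> - (\<i> * of_real (m * \<theta>) - of_real (\<sigma>\<^sup>2 * \<theta>\<^sup>2 / 2))) \<in> o[at 0](\<lambda>\<theta>. of_real (\<theta>\<^sup>2))"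

definition total_exponent :: "('d::finite \<Rightarrow> real \<Rightarrow> complex) \<Rightarrow> real ^ 'd \<Rightarrow> complex" where
  "total_exponent \<phi> \<xi> = (\<Sum>j\<in>UNIV. \<phi> j (\<xi> $ j))"

definition has_residues ::
  "(real ^ 'd \<Rightarrow> complex) \<Rightarrow> (nat \<Rightarrow> real) \<Rightarrow> (nat \<Rightarrow> int ^ 'd \<Rightarrow> real) \<Rightarrow>
   (nat \<Rightarrow> real ^ 'd \<Rightarrow> complex) \<Rightarrow> (real ^ 'd \<Rightarrow> complex) \<Rightarrow> bool" where
  "has_residues \<Phi> l m \<rho> \<rho>lim \<longleftrightarrow>
     filterlim l at_top sequentially \<and>
     (\<forall>n \<xi>. fourier_transform (m n) \<xi> = exp (of_real (l n) * \<Phi> \<xi>) * \<rho> n \<xi>) \<and>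
     (\<forall>n. \<rho> n \<in> wiener_algebra) \<and> \<rho>lim \<in> wiener_algebra \<and>
     uniform_limit UNIV \<rho> \<rho>lim sequentially"

text \<open>Only the laws matter, so the random variables may live on different probability spaces.\<close>

definition mod_phi_convergent ::
  "(real ^ 'd \<Rightarrow> complex) \<Rightarrow> (nat \<Rightarrow> real) \<Rightarrow> (nat \<Rightarrow> 'a measure) \<Rightarrow> (nat \<Rightarrow> 'a \<Rightarrow> int ^ 'd) \<Rightarrow>
   (nat \<Rightarrow> real ^ 'd \<Rightarrow> complex) \<Rightarrow> (real ^ 'd \<Rightarrow> complex) \<Rightarrow> bool" where
  "mod_phi_convergent \<Phi> l M X \<psi> \<psi>lim \<longleftrightarrow>
     has_residues \<Phi> l (\<lambda>n. law_mass (M n) (X n)) \<psi> \<psi>lim"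

definition approximation_scheme ::
  "(real ^ 'd \<Rightarrow> complex) \<Rightarrow> (nat \<Rightarrow> real) \<Rightarrow> (nat \<Rightarrow> int ^ 'd \<Rightarrow> real) \<Rightarrow>
   (nat \<Rightarrow> real ^ 'd \<Rightarrow> complex) \<Rightarrow> (real ^ 'd \<Rightarrow> complex) \<Rightarrow> bool" where
  "approximation_scheme \<Phi> l \<nu> chi chilim \<longleftrightarrow>
     (\<forall>n. (\<lambda>k. \<bar>\<nu> n k\<bar>) summable_on UNIV) \<and>
     has_residues \<Phi> l \<nu> chi chilim \<and>
     (\<forall>n. chi n 0 = 1) \<and> chilim 0 = 1"

definition multi_indices :: "nat \<Rightarrow> (nat ^ 'd) set" where
  "multi_indices s = {\<alpha>. (\<Sum>i\<in>UNIV. \<alpha> $ i) = s}"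

definition imonom :: "nat ^ 'd \<Rightarrow> real ^ 'd \<Rightarrow> complex" where
  "imonom \<alpha> \<xi> = (\<Prod>j\<in>UNIV. (\<i> * of_real (\<xi> $ j)) ^ (\<alpha> $ j))"

definition hermite :: "nat \<Rightarrow> real \<Rightarrow> real" where
  "hermite s x = (-1) ^ s * exp (x\<^sup>2 / 2) * (deriv ^^ s) (\<lambda>t. exp (- (t\<^sup>2 / 2))) x"

definition multi_hermite :: "nat ^ 'd \<Rightarrow> real ^ 'd \<Rightarrow> real" where
  "multi_hermite \<alpha> x = (\<Prod>i\<in>UNIV. hermite (\<alpha> $ i) (x $ i))"

end

(* By Fourier inversion, (2 pi)^d (mu_n - nu_n)({k}) is the integral over the torus of
   exp (lambda_n phi) (psi_n - chi_n) against the character of -k.  Infinite divisibility and the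
   absence of a proper sublattice give Re phi_j t <= - c t^2 on [-pi, pi], and the expansion at 0
   together with uniform convergence gives |psi_n - chi_n| <= C |xi|^(r+1) on the whole torus.  After
   the substitution xi_j = x_j / (sigma_j sqrt lambda_n) the integrand, multiplied by
   lambda_n^((r+1)/2), is therefore dominated by a Gaussian, and it converges to
   exp (- |x|^2 / 2) times the sum of beta^alpha (i x)^alpha / sigma^alpha, whose Fourier transform
   is the Hermite profile.  L^1 convergence of the integrands makes this uniform in k, and the points
   at which the profile is sampled become dense. *)
theory Submission
  imports Defs
begin

section \<open>Product integrals and Fourier inversion\<close>

text \<open>The lattice hypothesis excludes supports inside a subgroup aZ, whereas a characteristic
  function of modulus 1 only places the support in a coset b + aZ. Infinite divisibility closes this
  gap. The resulting Gaussian bound holds on the whole torus, so the integral is treated in one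
  piece, without a central region and a tail.

  A nonzero drift \<open>m j\<close> contributes an oscillation of order \<open>sqrt (l n)\<close>,
  which has no limit after rescaling. It has modulus 1, so it is moved from the integrand into the
  frequency: the character at the integer point \<open>k\<close> becomes a wave at the real point
  \<open>rescaled_point m \<sigma> (l n) k\<close>. In direction \<open>j\<close> these points form
  a grid of mesh \<open>1 / (\<sigma> j * sqrt (l n))\<close>, whence their density.

  Of the exponent (r + d + 1)/2, the part d/2 is the Jacobian and (r + 1)/2 the homogeneity of the
  leading terms. Inversion brings (2 pi)^d and the Gaussian transform sqrt(2 pi)^d, which leaves the
  stated constant.\<close>

lemma Basis_vec_range: "(Basis :: (real ^ 'd::finite) set) = range (\<lambda>i. axis i 1)"
  by (auto simp: Basis_vec_def)

lemma inj_axis: "inj (\<lambda>i::'d::finite. axis i (1::real))"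
  by (auto simp: inj_on_def axis_eq_axis)

lemma prod_Basis_vec:
  fixes g :: "real ^ 'd::finite \<Rightarrow> 'b::comm_monoid_mult"
  shows "(\<Prod>b\<in>Basis. g b) = (\<Prod>i\<in>UNIV. g (axis i 1))"
  unfolding Basis_vec_range by (subst prod.reindex[OF inj_axis]) simp

lemma sum_Basis_vec:
  fixes g :: "real ^ 'd::finite \<Rightarrow> 'b::comm_monoid_add"
  shows "(\<Sum>b\<in>Basis. g b) = (\<Sum>i\<in>UNIV. g (axis i 1))"
  unfolding Basis_vec_range by (subst sum.reindex[OF inj_axis]) simp

lemma borel_measurable_vec_lambda:
  "(\<lambda>f. \<chi> i::'d::finite. f i) \<in> (\<Pi>\<^sub>M i\<in>UNIV. lborel :: real measure) \<rightarrow>\<^sub>M (borel :: (real ^ 'd) measure)"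
  by (subst borel_measurable_euclidean_space)
    (auto simp: Basis_vec_def inner_axis intro!: measurable_PiM_component_rev)

text \<open>Transports the product structure to \<open>real ^ 'd\<close>, so that integrals of
  products of coordinate functions reduce to dimension one. A measure that agrees with volume on
  open boxes is \<open>lborel\<close>, and a box pulls back to a product of intervals.\<close>

lemma lborel_vec_eq:
  "lborel = distr (\<Pi>\<^sub>M i\<in>UNIV. lborel :: real measure) borel (\<lambda>f. \<chi> i::'d::finite. f i)"
proof (rule lborel_eqI)
  interpret product_sigma_finite "\<lambda>_::'d. lborel :: real measure" ..
  fix l u :: "real ^ 'd" assume le: "\<And>b. b \<in> Basis \<Longrightarrow> l \<bullet> b \<le> u \<bullet> b"
  then have le': "l $ i \<le> u $ i" for i
    by (force simp: Basis_vec_def inner_axis)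
  have vimage: "(\<lambda>f. \<chi> i. f i) -` box l u \<inter> space (\<Pi>\<^sub>M i\<in>UNIV. lborel) = Pi\<^sub>E UNIV (\<lambda>i::'d. {l $ i<..<u $ i})"
    by (auto simp: mem_box_cart space_PiM PiE_UNIV_domain Pi_iff)
  have "emeasure (distr (\<Pi>\<^sub>M i\<in>UNIV. lborel :: real measure) borel (\<lambda>f. \<chi> i::'d. f i)) (box l u)
      = emeasure (\<Pi>\<^sub>M i\<in>UNIV. lborel) (Pi\<^sub>E UNIV (\<lambda>i::'d. {l $ i<..<u $ i}))"
    by (subst emeasure_distr) (simp_all add: borel_measurable_vec_lambda vimage)
  also have "\<dots> = (\<Prod>i\<in>UNIV. emeasure lborel {l $ i<..<u $ i})"
    by (subst emeasure_PiM) auto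
  also have "\<dots> = (\<Prod>i\<in>UNIV. ennreal (u $ i - l $ i))"
    using le' by simp
  also have "\<dots> = (\<Prod>b\<in>Basis. (u - l) \<bullet> b)"
    using le' by (simp add: prod_Basis_vec inner_axis prod_ennreal)
  finally show "emeasure (distr (\<Pi>\<^sub>M i\<in>UNIV. lborel :: real measure) borel (\<lambda>f. \<chi> i::'d. f i)) (box l u)
      = (\<Prod>b\<in>Basis. (u - l) \<bullet> b)" .
qed simp

text \<open>Serves three times: for orthogonality of the characters, for the Gaussian moments and
  for integrability of the dominating function.\<close>

lemma
  fixes f :: "'d::finite \<Rightarrow> real \<Rightarrow> 'b::{real_normed_field,banach,second_countable_topology}"
  assumes f: "\<And>i. integrable lborel (f i)"
  shows integrable_prod_vec: "integrable lborel (\<lambda>x::real ^ 'd. \<Prod>i\<in>UNIV. f i (x $ i))" (is ?A)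
    and integral_prod_vec:
      "(\<integral>x. (\<Prod>i\<in>UNIV. f i ((x :: real ^ 'd) $ i)) \<partial>lborel) = (\<Prod>i\<in>UNIV. \<integral>x. f i x \<partial>lborel)" (is ?B)
proof -
  interpret product_sigma_finite "\<lambda>_::'d. lborel :: real measure" ..
  have [measurable]: "f i \<in> borel_measurable borel" for i
    using borel_measurable_integrable[OF f[of i]] by simp
  have meas: "(\<lambda>x::real ^ 'd. \<Prod>i\<in>UNIV. f i (x $ i)) \<in> borel_measurable borel"
    by measurable
  show ?A
    unfolding lborel_vec_eq
    by (subst integrable_distr_eq[OF borel_measurable_vec_lambda meas])
      (use product_integrable_prod[of UNIV f] f in simp)
  have "(\<integral>x. (\<Prod>i\<in>UNIV. f i ((x :: real ^ 'd) $ i)) \<partial>lborel) =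
     (\<integral>x. (\<Prod>i\<in>UNIV. f i (x i)) \<partial>(\<Pi>\<^sub>M i\<in>UNIV. lborel))"
    unfolding lborel_vec_eq
    by (subst integral_distr[OF borel_measurable_vec_lambda meas]) simp
  also have "\<dots> = (\<Prod>i\<in>UNIV. \<integral>x. f i x \<partial>lborel)"
    using product_integral_prod[of UNIV f] f by simp
  finally show ?B .
qed

section \<open>Orthogonality of characters and inversion on the torus\<close>

lemma integral_exp_period:
  "(\<integral>t. indicator {-pi..pi} t *\<^sub>R exp (\<i> * of_real (of_int k * t)) \<partial>lborel) = (if k = 0 then 2 * of_real pi else 0 :: complex)"
proof (cases "k = 0")
  case True
  then show ?thesis
    by (simp add: scaleR_conv_of_real)
next
  case False
  define F where "F = (\<lambda>t. exp (\<i> * of_real (of_int k * t)) / (\<i> * of_int k))"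
  have "(\<integral>t. indicator {-pi..pi} t *\<^sub>R exp (\<i> * of_real (of_int k * t)) \<partial>lborel) = F pi - F (-pi)"
  proof (rule integral_FTC_atLeastAtMost)
    fix x :: real
    show "(F has_vector_derivative exp (\<i> * of_real (of_int k * x))) (at x within {-pi..pi})"
      unfolding F_def using False
      by (auto intro!: derivative_eq_intros has_vector_derivative_real_field simp: field_simps)
  qed (auto intro!: continuous_intros)
  also have "F pi = F (-pi)"
  proof -
    have "exp (\<i> * of_real (of_int k * pi)) = exp (\<i> * of_real (of_int k * (-pi)) + \<i> * of_int k * of_real (2 * pi))"
      by (simp add: algebra_simps)
    also have "\<dots> = exp (\<i> * of_real (of_int k * (-pi)))"
      using exp_plus_2pin[of "\<i> * of_real (of_int k * (-pi))" k] by (simp add: algebra_simps)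
    finally show ?thesis
      by (simp add: F_def)
  qed
  finally show ?thesis
    using False by simp
qed

text \<open>An abbreviation, so that it is the same term as the exponential inside
  \<open>fourier_series_def\<close>.\<close>

abbreviation wave :: "int ^ 'd \<Rightarrow> real ^ 'd \<Rightarrow> complex" where
  "wave k \<xi> \<equiv> exp (\<i> * complex_of_real (\<Sum>j\<in>UNIV. of_int (k $ j) * \<xi> $ j))"

text \<open>A period cell centred at 0, so that its coordinates satisfy
  \<open>\<bar>\<theta>\<bar> \<le> pi\<close> as in the decay bound. Closing it adds only null
  faces and makes it compact.\<close>

definition torus_cube :: "(real ^ 'd) set" where
  "torus_cube = cbox (\<chi> i. -pi) (\<chi> i. pi)"

lemma indicator_torus_cube:
  "indicator torus_cube \<xi> = (\<Prod>j\<in>UNIV. indicator {-pi..pi} (\<xi> $ j :: real) :: 'b::{comm_semiring_1})"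
  for \<xi> :: "real ^ 'd::finite"
proof (cases "\<xi> \<in> torus_cube")
  case True
  then show ?thesis by (auto simp: torus_cube_def mem_box_cart indicator_def)
next
  case False
  then obtain j where "\<xi> $ j \<notin> {-pi..pi}" by (auto simp: torus_cube_def mem_box_cart)
  with False show ?thesis
    by (metis UNIV_I finite indicator_simps(2) prod_zero)
qed

lemma wave_eq_prod: "wave k \<xi> = (\<Prod>j\<in>UNIV. exp (\<i> * of_real (of_int (k $ j) * \<xi> $ j)))"
  by (simp add: sum_distrib_left exp_sum)

lemma torus_cube_measurable [measurable, simp]: "torus_cube \<in> sets borel"
  by (simp add: torus_cube_def)

lemma continuous_wave [continuous_intros]: "continuous_on A (wave k)"
  by (intro continuous_intros)

lemma emeasure_torus_cube: "emeasure lborel (torus_cube :: (real ^ 'd::finite) set) < \<infinity>"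
  using emeasure_lborel_cbox_finite by (simp add: torus_cube_def)

lemma integrable_torus_cube:
  fixes f :: "real ^ 'd::finite \<Rightarrow> 'b::{banach,second_countable_topology}"
  assumes "continuous_on UNIV f"
  shows "integrable lborel (\<lambda>\<xi>. indicator torus_cube \<xi> *\<^sub>R f \<xi>)"
  using borel_integrable_compact[of torus_cube f] assms
  by (auto simp: torus_cube_def intro: continuous_on_subset)

lemma integral_wave:
  "(\<integral>\<xi>. indicator torus_cube \<xi> *\<^sub>R wave k \<xi> \<partial>lborel) =
     (if k = 0 then (2 * of_real pi) ^ CARD('d::finite) else 0)" for k :: "int ^ 'd"
proof -
  have "(\<integral>\<xi>. indicator torus_cube \<xi> *\<^sub>R wave k \<xi> \<partial>lborel) =
    (\<integral>\<xi>. (\<Prod>j\<in>UNIV. indicator {-pi..pi} (\<xi> $ j) *\<^sub>R exp (\<i> * of_real (of_int (k $ j) * \<xi> $ j))) \<partial>lborel)"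
    unfolding scaleR_conv_of_real wave_eq_prod indicator_torus_cube prod.distrib of_real_prod ..
  also have "\<dots> = (\<Prod>j\<in>UNIV. \<integral>t. indicator {-pi..pi} t *\<^sub>R exp (\<i> * of_real (of_int (k $ j) * t)) \<partial>lborel)"
    by (rule integral_prod_vec) (auto intro!: borel_integrable_compact continuous_intros)
  also have "\<dots> = (\<Prod>j\<in>UNIV. if k $ j = 0 then 2 * of_real pi else 0)"
    unfolding integral_exp_period ..
  also have "\<dots> = (if k = 0 then (2 * of_real pi) ^ CARD('d) else 0)"
    by (auto simp: vec_eq_iff intro!: prod_zero)
  finally show ?thesis .
qed

text \<open>\<open>infsum\<close> is an unordered sum, so the Weierstrass test runs along the filter
  of finite subsets. Uniformity gives both continuity of the sum and passage of the limit through
  the integral.\<close>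

lemma fourier_series_uniform_limit:
  fixes c :: "int ^ 'd::finite \<Rightarrow> complex"
  assumes "(\<lambda>k. norm (c k)) summable_on UNIV"
  shows "uniform_limit UNIV (\<lambda>K \<xi>. \<Sum>k\<in>K. c k * wave k \<xi>) (fourier_series c) (finite_subsets_at_top UNIV)"
  using Weierstrass_m_test_general[of UNIV UNIV "\<lambda>k \<xi>. c k * wave k \<xi>" "\<lambda>k. norm (c k)"] assms
  unfolding fourier_series_def[abs_def] by (simp add: norm_mult)

lemma continuous_fourier_series:
  fixes c :: "int ^ 'd::finite \<Rightarrow> complex"
  assumes "(\<lambda>k. norm (c k)) summable_on UNIV"
  shows "continuous_on UNIV (fourier_series c)"
  by (rule uniform_limit_theorem[OF _ fourier_series_uniform_limit[OF assms]])
    (auto intro!: always_eventually continuous_intros)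

lemma fourier_series_bounded:
  fixes c :: "int ^ 'd::finite \<Rightarrow> complex"
  assumes "(\<lambda>k. norm (c k)) summable_on UNIV"
  shows "norm (fourier_series c \<xi>) \<le> (\<Sum>\<^sub>\<infinity>k. norm (c k))"
proof -
  have "norm (fourier_series c \<xi>) \<le> (\<Sum>\<^sub>\<infinity>k. norm (c k * wave k \<xi>))"
    unfolding fourier_series_def using assms by (intro norm_infsum_bound) (simp add: norm_mult)
  then show ?thesis
    by (simp add: norm_mult)
qed

text \<open>Two limits of the same net of integrals are compared. Uniform convergence on a cube of
  finite volume gives the integral of the full series; orthogonality makes each partial integral
  equal to the right-hand side as soon as \<open>K\<close> contains \<open>k\<close>.\<close>

lemma fourier_inversion:
  fixes c :: "int ^ 'd::finite \<Rightarrow> complex"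
  assumes c: "(\<lambda>k. norm (c k)) summable_on UNIV"
  shows "(\<integral>\<xi>. indicator torus_cube \<xi> *\<^sub>R (fourier_series c \<xi> * wave (- k) \<xi>) \<partial>lborel)
     = (2 * of_real pi) ^ CARD('d) * c k" (is "?I = ?c")
proof (rule tendsto_unique[OF finite_subsets_at_top_neq_bot])
  define S where "S = (\<lambda>K \<xi>. \<Sum>k\<in>K. c k * wave k \<xi>)"
  define V where "V = (\<integral>\<xi>. indicator (torus_cube :: (real ^ 'd) set) \<xi> \<partial>lborel :: real)"
  have V: "integrable lborel (indicator (torus_cube :: (real ^ 'd) set) :: _ \<Rightarrow> real)"
    using emeasure_torus_cube[where 'd='d] by (simp add: less_top)
  have V0: "V \<ge> 0" unfolding V_def by simp
  have cont_f: "continuous_on UNIV (\<lambda>\<xi>. fourier_series c \<xi> * wave (- k) \<xi>)"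
    by (intro continuous_intros continuous_fourier_series c)
  have cont_S: "continuous_on UNIV (\<lambda>\<xi>. S K \<xi> * wave (- k) \<xi>)" for K
    unfolding S_def by (intro continuous_intros)
  show "((\<lambda>K. \<integral>\<xi>. indicator torus_cube \<xi> *\<^sub>R (S K \<xi> * wave (- k) \<xi>) \<partial>lborel) \<longlongrightarrow> ?I) (finite_subsets_at_top UNIV)"
  proof (rule tendstoI)
    fix e :: real assume "e > 0"
    \<comment> \<open>\<open>V + 1\<close> instead of \<open>V\<close> keeps the quotient defined
      from \<open>V \<ge> 0\<close> alone and makes \<open>e' * V < e\<close> strict.\<close>
    define e' where "e' = e / (V + 1)"
    have e': "e' > 0" "e' * V < e" using \<open>e > 0\<close> V0 by (auto simp: e'_def field_simps)
    have "\<forall>\<^sub>F K in finite_subsets_at_top UNIV. \<forall>\<xi>\<in>UNIV. dist (S K \<xi>) (fourier_series c \<xi>) < e'"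
      unfolding S_def by (rule uniform_limitD[OF fourier_series_uniform_limit[OF c] e'(1)])
    then show "\<forall>\<^sub>F K in finite_subsets_at_top UNIV.
      dist (\<integral>\<xi>. indicator torus_cube \<xi> *\<^sub>R (S K \<xi> * wave (- k) \<xi>) \<partial>lborel) ?I < e"
    proof eventually_elim
      case (elim K)
      have int: "integrable lborel (\<lambda>\<xi>. indicator torus_cube \<xi> *\<^sub>R (S K \<xi> * wave (- k) \<xi>))"
        "integrable lborel (\<lambda>\<xi>. indicator torus_cube \<xi> *\<^sub>R (fourier_series c \<xi> * wave (- k) \<xi>))"
        using integrable_torus_cube[OF cont_f] integrable_torus_cube[OF cont_S] by auto
      have "dist (\<integral>\<xi>. indicator torus_cube \<xi> *\<^sub>R (S K \<xi> * wave (- k) \<xi>) \<partial>lborel) ?I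
        = norm (\<integral>\<xi>. (indicator torus_cube \<xi> *\<^sub>R (S K \<xi> * wave (- k) \<xi>)
             - indicator torus_cube \<xi> *\<^sub>R (fourier_series c \<xi> * wave (- k) \<xi>)) \<partial>lborel)"
        using int by (subst Bochner_Integration.integral_diff) (auto simp: dist_norm)
      also have "\<dots> \<le> (\<integral>\<xi>. e' * indicator (torus_cube :: (real ^ 'd) set) \<xi> \<partial>lborel)"
      proof (rule Bochner_Integration.integral_norm_bound_integral)
        fix \<xi> :: "real ^ 'd"
        have "norm (S K \<xi> - fourier_series c \<xi>) \<le> e'"
          using elim by (auto simp: dist_norm intro: less_imp_le)
        then show "norm (indicator torus_cube \<xi> *\<^sub>R (S K \<xi> * wave (- k) \<xi>)
             - indicator torus_cube \<xi> *\<^sub>R (fourier_series c \<xi> * wave (- k) \<xi>)) \<le> e' * indicator torus_cube \<xi>"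
          by (auto simp: indicator_def norm_mult simp flip: left_diff_distrib)
      qed (use int V in auto)
      also have "\<dots> = e' * V" by (simp add: V_def)
      finally show ?case using e' by simp
    qed
  qed
  have "(\<integral>\<xi>. indicator torus_cube \<xi> *\<^sub>R (S K \<xi> * wave (- k) \<xi>) \<partial>lborel) = ?c"
    if K: "finite K" "k \<in> K" for K
  proof -
    have *: "indicator torus_cube \<xi> *\<^sub>R (S K \<xi> * wave (- k) \<xi>) =
        (\<Sum>l\<in>K. c l * (indicator torus_cube \<xi> *\<^sub>R wave (l - k) \<xi>))" for \<xi> :: "real ^ 'd"
    proof -
      have "wave l \<xi> * wave (- k) \<xi> = wave (l - k) \<xi>" for l
        by (simp add: algebra_simps sum.distrib sum_subtractf sum_negf flip: exp_add)
      then show ?thesis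
        by (simp add: S_def sum_distrib_right scaleR_sum_right mult.assoc)
    qed
    have "(\<integral>\<xi>. indicator torus_cube \<xi> *\<^sub>R (S K \<xi> * wave (- k) \<xi>) \<partial>lborel)
       = (\<Sum>l\<in>K. c l * (\<integral>\<xi>. indicator torus_cube \<xi> *\<^sub>R wave (l - k) \<xi> \<partial>lborel))"
      unfolding *
      by (subst Bochner_Integration.integral_sum)
        (intro integrable_mult_right integrable_torus_cube continuous_wave,
         simp only: integral_mult_right_zero)
    also have "\<dots> = (\<Sum>l\<in>K. if l = k then ?c else 0)"
      unfolding integral_wave by (intro sum.cong refl) auto
    finally show ?thesis using K by simp
  qed
  then show "((\<lambda>K. \<integral>\<xi>. indicator torus_cube \<xi> *\<^sub>R (S K \<xi> * wave (- k) \<xi>) \<partial>lborel) \<longlongrightarrow> ?c) (finite_subsets_at_top UNIV)"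
    by (intro tendsto_eventually)
      (auto simp: eventually_finite_subsets_at_top intro!: exI[of _ "{k}"])
qed

section \<open>The reference exponent\<close>

text \<open>The modulus itself is taken as the number of summands: the support of an
  \<open>a\<close>-th convolution root \<open>q\<close> lies in a single class modulo
  \<open>a\<close>, and a sum of \<open>a\<close> members of one class is divisible by
  \<open>a\<close>.\<close>

lemma infinitely_divisible_coset:
  fixes a :: nat
  assumes p: "infinitely_divisible p" and a: "a \<ge> 1"
    and diff: "\<And>k k'. k \<in> set_pmf p \<Longrightarrow> k' \<in> set_pmf p \<Longrightarrow> int a dvd k - k'"
  shows "set_pmf p \<subseteq> range ((*) (int a))"
proof -
  obtain q where q: "p = map_pmf sum_list (replicate_pmf a q)"
    using p a unfolding infinitely_divisible_def by blast
  have set_p: "set_pmf p = sum_list ` {xs \<in> lists (set_pmf q). length xs = a}"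
    unfolding q by (simp add: set_replicate_pmf)
  obtain y where y: "y \<in> set_pmf q" using set_pmf_not_empty[of q] by blast
  \<comment> \<open>Two sums of \<open>a\<close> atoms of \<open>q\<close> that differ in one entry,
    \<open>x\<close> against \<open>y\<close>, are both atoms of \<open>p\<close>.\<close>
  have q_diff: "int a dvd x - y" if "x \<in> set_pmf q" for x
  proof -
    have "sum_list (x # replicate (a - 1) y) \<in> set_pmf p" "sum_list (replicate a y) \<in> set_pmf p"
      unfolding set_p using that y a by (auto simp: in_lists_conv_set intro!: imageI simp del: sum_list.Cons)
    from diff[OF this] show ?thesis
      using a by (simp add: sum_list_replicate of_nat_diff algebra_simps)
  qed
  \<comment> \<open>Modulo \<open>a\<close> every entry is \<open>y\<close>. At length
    \<open>a\<close> the subtracted term is a multiple of \<open>a\<close>, so the sum is one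
    too.\<close>
  have "int a dvd sum_list xs - int (length xs) * y" if "xs \<in> lists (set_pmf q)" for xs
    using that
  proof (induction xs)
    case (Cons x xs)
    have "sum_list (x # xs) - int (length (x # xs)) * y = (x - y) + (sum_list xs - int (length xs) * y)"
      by (simp add: algebra_simps)
    moreover have "int a dvd (x - y) + (sum_list xs - int (length xs) * y)"
      using Cons q_diff[of x] by (intro dvd_add) auto
    ultimately show ?case by metis
  qed simp
  then have "int a dvd k" if "k \<in> set_pmf p" for k
    using that unfolding set_p by (force simp: dvd_diff_left_iff dest: dvd_diffD1)
  then show ?thesis by (auto simp: dvd_def)
qed

text \<open>Equality case of the triangle inequality. After rotation by \<open>cnj z\<close> the
  integrand has real part at most 1 with mean 1, so the real part is 1 at every atom; modulus 1 then
  kills the imaginary part.\<close>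

lemma norm_char_eq_1_imp:
  fixes p :: "int pmf"
  assumes "norm (char (distr (measure_pmf p) borel real_of_int) \<theta>) = 1" "k \<in> set_pmf p"
  shows "exp (\<i> * of_real (\<theta> * of_int k)) = char (distr (measure_pmf p) borel real_of_int) \<theta>"
proof -
  define z where "z = char (distr (measure_pmf p) borel real_of_int) \<theta>"
  define w where "w = (\<lambda>k::int. exp (\<i> * complex_of_real (\<theta> * of_int k)))"
  have z: "z = (\<integral>k. w k \<partial>measure_pmf p)"
    unfolding z_def w_def char_def by (subst integral_distr) auto
  have int: "integrable (measure_pmf p) w"
    by (rule measure_pmf.integrable_const_bound[where B=1]) (auto simp: w_def)
  have nz: "norm z = 1" using assms by (simp add: z_def)
  have zz: "cnj z * z = 1" using nz by (simp add: complex_norm_square[symmetric] mult.commute)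
  have "(\<integral>k. 1 - Re (cnj z * w k) \<partial>measure_pmf p) = 1 - Re (cnj z * (\<integral>k. w k \<partial>measure_pmf p))"
    using int by (simp add: integral_Re)
  also have "\<dots> = 0" using zz by (simp add: z[symmetric] del: mult_minus1)
  finally have "(\<integral>k. 1 - Re (cnj z * w k) \<partial>measure_pmf p) = 0" .
  moreover have le: "norm (cnj z * w k) = 1" for k using nz by (simp add: norm_mult w_def)
  then have "Re (cnj z * w k) \<le> 1" for k using complex_Re_le_cmod[of "cnj z * w k"] by simp
  moreover have "integrable (measure_pmf p) (\<lambda>k. 1 - Re (cnj z * w k))"
    using int by auto
  ultimately have "AE k in measure_pmf p. 1 - Re (cnj z * w k) = 0"
    by (subst (asm) integral_nonneg_eq_0_iff_AE) auto
  then have "Re (cnj z * w k) = 1"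
    using assms(2) by (auto simp: AE_measure_pmf_iff)
  moreover have "Im (cnj z * w k) = 0"
    using le[of k] calculation by (simp add: cmod_def)
  ultimately have "cnj z * w k = cnj z * z"
    unfolding zz by (simp add: complex_eq_iff)
  moreover have "cnj z \<noteq> 0" using nz by auto
  ultimately show ?thesis unfolding z_def w_def by simp
qed

text \<open>The drift is imaginary and drops out. Of the coefficient
  \<open>\<sigma>\<^sup>2 / 2\<close>, half is spent on absorbing the error term.\<close>

lemma reference_exponent_Re_near_0:
  assumes "reference_exponent p f m \<sigma>"
  shows "\<forall>\<^sub>F \<theta> in at 0. Re (f \<theta>) \<le> - (\<sigma>\<^sup>2 / 4) * \<theta>\<^sup>2"
proof -
  have \<sigma>: "\<sigma> > 0" and o: "(\<lambda>\<theta>. f \<theta> - (\<i> * of_real (m * \<theta>) - of_real (\<sigma>\<^sup>2 * \<theta>\<^sup>2 / 2))) \<in> o[at 0](\<lambda>\<theta>. of_real (\<theta>\<^sup>2))"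
    using assms unfolding reference_exponent_def by auto
  have "\<forall>\<^sub>F \<theta> in at 0. norm (f \<theta> - (\<i> * of_real (m * \<theta>) - of_real (\<sigma>\<^sup>2 * \<theta>\<^sup>2 / 2))) \<le> \<sigma>\<^sup>2 / 4 * norm (complex_of_real (\<theta>\<^sup>2))"
    using landau_o.smallD[OF o, of "\<sigma>\<^sup>2 / 4"] \<sigma> by simp
  then show ?thesis
  proof eventually_elim
    case (elim \<theta>)
    have "Re (f \<theta>) + \<sigma>\<^sup>2 * \<theta>\<^sup>2 / 2 \<le> norm (f \<theta> - (\<i> * of_real (m * \<theta>) - of_real (\<sigma>\<^sup>2 * \<theta>\<^sup>2 / 2)))"
      by (rule order_trans[OF _ complex_Re_le_cmod]) simp
    with elim show ?case by (simp add: norm_power)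
  qed
qed

text \<open>If the real part vanished, the character would be constant on the support, so the
  integers with trivial character would form a subgroup containing all differences of atoms. Its
  generator \<open>a\<close> puts the support into a coset, hence into aZ, so \<open>a = 1\<close>
  and \<open>\<theta>\<close> is a period.\<close>

lemma reference_exponent_Re_neg:
  assumes ref: "reference_exponent p f m \<sigma>" and \<theta>: "\<And>n::int. \<theta> \<noteq> 2 * pi * n"
  shows "Re (f \<theta>) < 0"
proof -
  let ?c = "char (distr (measure_pmf p) borel real_of_int)"
  have id: "infinitely_divisible p" and lat: "\<And>a::nat. a \<noteq> 1 \<Longrightarrow> \<not> set_pmf p \<subseteq> range ((*) (int a))"
    and char: "\<And>\<theta>. ?c \<theta> = exp (f \<theta>)" and \<sigma>: "\<sigma> > 0"
    using ref unfolding reference_exponent_def by auto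
  interpret D: real_distribution "distr (measure_pmf p) borel real_of_int"
    by (intro prob_space.real_distribution_distr) (auto intro: prob_space_measure_pmf)
  have norm_char: "norm (?c t) = exp (Re (f t))" for t by (simp add: char)
  have le: "Re (f t) \<le> 0" for t using D.cmod_char_le_1[of t] norm_char[of t] by simp
  have "Re (f \<theta>) \<noteq> 0"
  proof
    assume "Re (f \<theta>) = 0"
    then have "norm (?c \<theta>) = 1" by (simp add: norm_char)
    note const = norm_char_eq_1_imp[OF this]
    define G where "G = {k::int. exp (\<i> * of_real (\<theta> * of_int k)) = 1}"
    have G_diff: "k - k' \<in> G" if "k \<in> set_pmf p" "k' \<in> set_pmf p" for k k'
      using const[OF that(1)] const[OF that(2)] char[of \<theta>] by (simp add: G_def algebra_simps exp_diff)
    have G_add: "k + k' \<in> G" if "k \<in> G" "k' \<in> G" for k k'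
      using that by (simp add: G_def algebra_simps exp_add)
    have G_uminus: "- k \<in> G" if "k \<in> G" for k
      using that by (simp add: G_def exp_minus)
    have G_nat: "int n * k \<in> G" if "k \<in> G" for n k
    proof (induction n)
      case (Suc n)
      then show ?case using G_add[OF that Suc] by (simp add: algebra_simps)
    qed (simp add: G_def)
    have G_mult: "n * k \<in> G" if "k \<in> G" for n k
      using G_nat[OF that, of "nat n"] G_uminus[OF G_nat[OF that, of "nat (- n)"]]
      by (cases "n \<ge> 0") auto
    show False
    proof (cases "\<exists>k\<in>set_pmf p. \<exists>k'\<in>set_pmf p. k \<noteq> k'")
      case True
      then obtain k k' where "k \<in> set_pmf p" "k' \<in> set_pmf p" "k > k'"
        by (metis linorder_neqE)
      then have "nat (k - k') \<ge> 1 \<and> int (nat (k - k')) \<in> G" using G_diff[of k k'] by simp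
      then have ex: "\<exists>a. a \<ge> 1 \<and> int a \<in> G" by blast
      \<comment> \<open>The least positive member generates \<open>G\<close>, because the remainder
        on division by it stays in \<open>G\<close>.\<close>
      define a where "a = (LEAST a. a \<ge> 1 \<and> int a \<in> G)"
      have a: "a \<ge> 1" "int a \<in> G" using LeastI_ex[OF ex] unfolding a_def by auto
      have dvd: "int a dvd k" if "k \<in> G" for k
      proof (rule ccontr)
        assume "\<not> int a dvd k"
        then have "k mod int a > 0" "k mod int a < int a"
          using a pos_mod_bound[of "int a" k] pos_mod_sign[of "int a" k] by (auto simp: dvd_eq_mod_eq_0 less_le)
        moreover have "k mod int a \<in> G"
          using G_add[OF that G_mult[OF a(2), of "- (k div int a)"]]
          by (simp add: minus_mult_div_eq_mod[symmetric] mult.commute)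
        ultimately have "nat (k mod int a) \<ge> 1 \<and> int (nat (k mod int a)) \<in> G" "nat (k mod int a) < a"
          by auto
        then show False using not_less_Least unfolding a_def by blast
      qed
      have "set_pmf p \<subseteq> range ((*) (int a))"
        by (rule infinitely_divisible_coset[OF id a(1)]) (intro dvd G_diff)
      then have "a = 1" using lat by blast
      then have "exp (\<i> * of_real \<theta>) = 1" using a(2) by (simp add: G_def)
      then obtain n :: int where "\<theta> = 2 * pi * n"
        by (auto simp: exp_eq_1 mult_ac)
      then show False using \<theta> by blast
    next
      \<comment> \<open>A point mass has no nonzero differences to work with. Its characteristic
        function has modulus 1 everywhere, against the quadratic decay that
        \<open>\<sigma> > 0\<close> forces near 0.\<close>
      case False
      then obtain k where k: "set_pmf p = {k}" using set_pmf_not_empty[of p] by blast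
      then have "p = return_pmf k" by (simp add: set_pmf_subset_singleton[symmetric])
      then have "norm (?c t) = 1" for t
        by (simp add: char_def integral_distr)
      then have "Re (f t) = 0" for t by (simp add: norm_char)
      moreover have "\<exists>t. t \<noteq> 0 \<and> Re (f t) \<le> - (\<sigma>\<^sup>2 / 4) * t\<^sup>2"
        using eventually_happens[OF eventually_conj[OF reference_exponent_Re_near_0[OF ref]
          eventually_neq_at_within[of 0 0 UNIV]]] by (auto simp: at_neq_bot)
      ultimately obtain t where "t \<noteq> 0" "(\<sigma>\<^sup>2 / 4) * t\<^sup>2 \<le> 0" by auto
      moreover have "(\<sigma>\<^sup>2 / 4) * t\<^sup>2 > 0" using \<sigma> \<open>t \<noteq> 0\<close> by simp
      ultimately show False by simp
    qed
  qed
  with le[of \<theta>] show ?thesis by simp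
qed

lemma reference_exponent_Re_bound:
  assumes ref: "reference_exponent p f m \<sigma>"
  obtains c where "c > 0" "\<And>\<theta>. \<bar>\<theta>\<bar> \<le> pi \<Longrightarrow> Re (f \<theta>) \<le> - c * \<theta>\<^sup>2"
proof -
  have \<sigma>: "\<sigma> > 0" and cont: "continuous_on UNIV f" and f0: "f 0 = 0"
    using ref unfolding reference_exponent_def by auto
  obtain d where d: "d > 0" "\<And>\<theta>. \<theta> \<noteq> 0 \<Longrightarrow> \<bar>\<theta>\<bar> < d \<Longrightarrow> Re (f \<theta>) \<le> - (\<sigma>\<^sup>2 / 4) * \<theta>\<^sup>2"
    using reference_exponent_Re_near_0[OF ref] unfolding eventually_at by (auto simp: dist_norm)
  define K where "K = {-pi..pi} - {-d<..<d}"
  have "compact K" unfolding K_def by (intro compact_diff) auto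
  \<comment> \<open>Away from 0, compactness turns pointwise negativity into a margin.
    \<open>K\<close> is empty when \<open>d > pi\<close>, and any positive \<open>M\<close> then
    serves.\<close>
  obtain M where M: "M > 0" "\<And>\<theta>. \<theta> \<in> K \<Longrightarrow> Re (f \<theta>) \<le> - M"
  proof (cases "K = {}")
    case False
    have "continuous_on K (\<lambda>\<theta>. Re (f \<theta>))"
      by (intro continuous_intros continuous_on_subset[OF cont]) auto
    from continuous_attains_sup[OF \<open>compact K\<close> False this]
    obtain t where t: "t \<in> K" "\<And>\<theta>. \<theta> \<in> K \<Longrightarrow> Re (f \<theta>) \<le> Re (f t)" by auto
    have "Re (f t) < 0"
    proof (rule reference_exponent_Re_neg[OF ref])
      fix n :: int
      show "t \<noteq> 2 * pi * n"
      proof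
        assume *: "t = 2 * pi * n"
        have "t \<noteq> 0" "\<bar>t\<bar> \<le> pi" using t(1) d(1) by (auto simp: K_def)
        then have "n \<noteq> 0" using * by auto
        then have "\<bar>n\<bar> \<ge> 1" by simp
        then have "\<bar>real_of_int n\<bar> \<ge> 1" by linarith
        then have "\<bar>t\<bar> \<ge> 2 * pi" unfolding * by (simp add: abs_mult)
        with \<open>\<bar>t\<bar> \<le> pi\<close> show False using pi_gt_zero by linarith
      qed
    qed
    with t(2) that[of "- Re (f t)"] show ?thesis by simp
  qed (auto intro: that[of 1])
  \<comment> \<open>The first entry serves near 0. On \<open>K\<close> the value is at most
    \<open>- M\<close>, which \<open>\<theta>\<^sup>2 \<le> pi\<^sup>2\<close> turns into a
    quadratic bound.\<close>
  define c where "c = min (\<sigma>\<^sup>2 / 4) (M / pi\<^sup>2)"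
  show thesis
  proof
    show "c > 0" using \<sigma> M by (simp add: c_def)
    fix \<theta> :: real assume \<theta>: "\<bar>\<theta>\<bar> \<le> pi"
    consider "\<theta> = 0" | "\<theta> \<noteq> 0" "\<bar>\<theta>\<bar> < d" | "\<theta> \<in> K" using \<theta> by (force simp: K_def)
    then show "Re (f \<theta>) \<le> - c * \<theta>\<^sup>2"
    proof cases
      case 2
      have "c * \<theta>\<^sup>2 \<le> (\<sigma>\<^sup>2 / 4) * \<theta>\<^sup>2" unfolding c_def by (intro mult_right_mono min.cobounded1) simp
      with d(2)[OF 2] show ?thesis by linarith
    next
      case 3
      have "c * \<theta>\<^sup>2 \<le> (M / pi\<^sup>2) * pi\<^sup>2"
        using \<theta> M by (intro mult_mono) (auto simp: c_def abs_le_square_iff[symmetric])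
      also have "\<dots> = M" by simp
      finally show ?thesis using M(2)[OF 3] by linarith
    qed (use f0 in simp)
  qed
qed

section \<open>Hermite polynomials and the Gaussian integral\<close>

text \<open>Differentiating a polynomial times \<open>exp (- (x\<^sup>2 / 2))\<close> gives this
  recursion up to sign, so the iterated derivative in \<open>hermite\<close> becomes
  algebraic.\<close>

primrec hermite_poly :: "nat \<Rightarrow> real poly" where
  "hermite_poly 0 = 1"
| "hermite_poly (Suc s) = pCons 0 (hermite_poly s) - pderiv (hermite_poly s)"

text \<open>The Appell property. It eliminates the derivative from the recursion and leaves a
  three-term recurrence of the kind that integration by parts produces.\<close>

lemma pderiv_hermite_poly: "pderiv (hermite_poly (Suc s)) = of_nat (Suc s) * hermite_poly s"
proof (induction s)
  case (Suc s)
  have "pderiv (hermite_poly (Suc (Suc s))) =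
      hermite_poly (Suc s) + pCons 0 (pderiv (hermite_poly (Suc s))) - pderiv (pderiv (hermite_poly (Suc s)))"
    by (simp add: pderiv_diff pderiv_pCons)
  also have "\<dots> = hermite_poly (Suc s) + of_nat (Suc s) * (pCons 0 (hermite_poly s) - pderiv (hermite_poly s))"
    unfolding Suc by (simp add: pderiv_smult of_nat_poly algebra_simps)
  also have "\<dots> = of_nat (Suc (Suc s)) * hermite_poly (Suc s)"
    by (simp add: algebra_simps)
  finally show ?case .
qed (simp add: pderiv_diff pderiv_pCons)

lemma deriv_gaussian:
  "(deriv ^^ s) (\<lambda>t. exp (- (t\<^sup>2 / 2))) = (\<lambda>x::real. (-1) ^ s * poly (hermite_poly s) x * exp (- (x\<^sup>2 / 2)))"
proof (induction s)
  case (Suc s)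
  have "((\<lambda>x. (-1) ^ s * poly (hermite_poly s) x * exp (- (x\<^sup>2 / 2))) has_real_derivative
      (-1) ^ Suc s * poly (hermite_poly (Suc s)) x * exp (- (x\<^sup>2 / 2))) (at x)" for x
    by (auto intro!: derivative_eq_intros poly_DERIV simp: algebra_simps)
  then show ?case
    by (auto simp: Suc intro!: DERIV_imp_deriv)
qed simp

lemma hermite_eq_poly: "hermite s x = poly (hermite_poly s) x"
proof -
  have "hermite s x = ((-1) ^ s * (-1) ^ s) * (exp (x\<^sup>2 / 2) * exp (- (x\<^sup>2 / 2))) * poly (hermite_poly s) x"
    unfolding hermite_def deriv_gaussian by (simp only: mult_ac)
  then show ?thesis
    by (simp flip: power_add exp_add mult_2)
qed

lemma continuous_hermite [continuous_intros]:
  "continuous_on A f \<Longrightarrow> continuous_on A (\<lambda>x. hermite s (f x))"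
  unfolding hermite_eq_poly by (intro continuous_intros)

lemma hermite_0 [simp]: "hermite 0 x = 1"
  by (simp add: hermite_eq_poly)

lemma hermite_Suc_0: "hermite (Suc 0) x = x"
  by (simp add: hermite_eq_poly)

lemma hermite_Suc_Suc: "hermite (Suc (Suc s)) x = x * hermite (Suc s) x - real (Suc s) * hermite s x"
proof -
  have "poly (hermite_poly (Suc (Suc s))) x = x * poly (hermite_poly (Suc s)) x - poly (pderiv (hermite_poly (Suc s))) x"
    by simp
  then show ?thesis
    unfolding hermite_eq_poly pderiv_hermite_poly by (simp add: of_nat_poly)
qed

section \<open>Fourier transform of a power times a Gaussian\<close>

definition hermite_kernel :: "nat \<Rightarrow> real \<Rightarrow> real \<Rightarrow> complex" where
  "hermite_kernel a y x = exp (- \<i> * of_real (y * x)) * (\<i> * of_real x) ^ a * of_real (exp (- (x\<^sup>2 / 2)))"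

lemma integrable_power_gaussian: "integrable lborel (\<lambda>x::real. x ^ a * exp (- (x\<^sup>2 / 2)))"
proof -
  have "integrable lborel (\<lambda>x::real. std_normal_density x * x ^ a)"
    by (rule integrable_std_normal_moment)
  then have "integrable lborel (\<lambda>x::real. sqrt (2 * pi) * (std_normal_density x * x ^ a))"
    by (rule integrable_mult_right)
  moreover have "sqrt (2 * pi) * (std_normal_density x * x ^ a) = x ^ a * exp (- (x\<^sup>2 / 2))" for x
    by (simp add: std_normal_density_def)
  ultimately show ?thesis by simp
qed

lemma norm_hermite_kernel: "norm (hermite_kernel a y x) = norm (x ^ a * exp (- (x\<^sup>2 / 2)))"
  by (simp add: hermite_kernel_def norm_mult norm_power abs_mult power_abs)

lemma integrable_hermite_kernel: "integrable lborel (hermite_kernel a y)"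
proof (rule Bochner_Integration.integrable_bound[OF integrable_power_gaussian[of a]])
  have "continuous_on UNIV (hermite_kernel a y)"
    unfolding hermite_kernel_def by (intro continuous_intros) auto
  then show "hermite_kernel a y \<in> borel_measurable lborel"
    by (simp add: borel_measurable_continuous_onI)
qed (simp add: norm_hermite_kernel)

text \<open>Supplies the vanishing boundary terms for the integration by parts.\<close>

lemma hermite_kernel_tendsto_0:
  assumes "F = at_top \<or> F = at_bot"
  shows "(hermite_kernel a y \<longlongrightarrow> 0) F"
proof (rule Lim_null_comparison)
  \<comment> \<open>This is (|x| - 1)^2 \<ge> 0. It trades the Gaussian for
    \<open>exp (- \<bar>x\<bar>)\<close>, against which every power is known to vanish.\<close>
  have "x\<^sup>2 / 2 \<ge> \<bar>x\<bar> - 1 / 2" for x :: real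
    using zero_le_power2[of "\<bar>x\<bar> - 1"] by (simp add: power2_diff)
  then have "norm (hermite_kernel a y x) \<le> exp (1 / 2) * (\<bar>x\<bar> ^ a / exp \<bar>x\<bar>)" for x
  proof -
    have "norm (hermite_kernel a y x) = \<bar>x\<bar> ^ a * exp (- (x\<^sup>2 / 2))"
      by (simp add: norm_hermite_kernel abs_mult power_abs)
    also have "\<dots> \<le> \<bar>x\<bar> ^ a * exp (1 / 2 - \<bar>x\<bar>)"
      using \<open>x\<^sup>2 / 2 \<ge> \<bar>x\<bar> - 1 / 2\<close> by (intro mult_left_mono) auto
    finally show ?thesis by (simp add: exp_diff mult_ac)
  qed
  then show "\<forall>\<^sub>F x in F. norm (hermite_kernel a y x) \<le> exp (1 / 2) * (\<bar>x\<bar> ^ a / exp \<bar>x\<bar>)"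
    by simp
  have "filterlim (abs :: real \<Rightarrow> real) at_top F"
    using assms
  proof
    assume "F = at_bot"
    then show ?thesis
      using filterlim_abs_real by (simp add: filterlim_at_bot_mirror)
  qed (simp add: filterlim_abs_real)
  then show "((\<lambda>x. exp (1 / 2) * (\<bar>x\<bar> ^ a / exp \<bar>x\<bar>)) \<longlongrightarrow> 0) F"
    by (intro tendsto_mult_right_zero filterlim_compose[OF tendsto_power_div_exp_0])
qed

text \<open>The derivative of \<open>hermite_kernel a y\<close> integrates to 0 over the line; after
  cancelling a factor \<open>\<i>\<close> this is the claim.\<close>

lemma integral_hermite_kernel_Suc:
  "(\<integral>x. hermite_kernel (Suc a) y x \<partial>lborel)
     = of_real y * (\<integral>x. hermite_kernel a y x \<partial>lborel) - of_nat a * (\<integral>x. hermite_kernel (a - 1) y x \<partial>lborel)"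
proof -
  \<comment> \<open>The derivative of the kernel in terms of its neighbours; the last summand comes
    from \<open>- x * (\<i> * x) ^ a = \<i> * (\<i> * x) ^ Suc a\<close>. For \<open>a = 0\<close>
    the truncated index \<open>a - 1\<close> is harmless, since its coefficient is 0.\<close>
  define g where "g = (\<lambda>x. - \<i> * of_real y * hermite_kernel a y x + \<i> * of_nat a * hermite_kernel (a - 1) y x
    + \<i> * hermite_kernel (Suc a) y x)"
  have g_int: "integrable lborel g"
    unfolding g_def by (intro Bochner_Integration.integrable_add integrable_mult_right integrable_hermite_kernel)
  have cont: "continuous_on UNIV g"
    unfolding g_def hermite_kernel_def by (intro continuous_intros) auto
  have "(LBINT x=-\<infinity>..\<infinity>. g x) = 0 - 0"
  proof (rule interval_integral_FTC_integrable)
    fix x :: real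
    show "(hermite_kernel a y has_vector_derivative g x) (at x)"
    proof -
      \<comment> \<open>The powers are hidden behind \<open>P\<close> and \<open>P'\<close>, so that
        the comparison with \<open>g\<close> is linear in them. The derivative is taken in a complex
        variable and only then restricted to the real line.\<close>
      define P where "P = (\<lambda>z. (\<i> * z) ^ a)"
      define P' where "P' = (\<i> * of_real x) ^ (a - 1)"
      have [derivative_intros]: "(P has_field_derivative of_nat a * P' * \<i>) (at (of_real x))"
        unfolding P_def P'_def by (auto intro!: derivative_eq_intros)
      have "((\<lambda>z. exp (- \<i> * (of_real y * z)) * P z * exp (- (z\<^sup>2 / 2))) has_field_derivative g x) (at (of_real x))"
      proof -
        have "g x = (- \<i> * of_real y * P (of_real x) + \<i> * of_nat a * P' - of_real x * P (of_real x))
           * exp (- \<i> * (of_real y * of_real x)) * exp (- ((of_real x)\<^sup>2 / 2))"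
          unfolding g_def hermite_kernel_def exp_of_real[symmetric] of_real_minus of_real_divide of_real_power
            P_def[symmetric] P'_def[symmetric] power_Suc
          by (simp add: P_def P'_def ring_distribs mult_ac)
        then show ?thesis
          by (auto intro!: derivative_eq_intros simp: algebra_simps)
      qed
      then have "((\<lambda>z. exp (- \<i> * (of_real y * z)) * (\<i> * z) ^ a * exp (- (z\<^sup>2 / 2))) has_field_derivative g x) (at (of_real x))"
        unfolding P_def .
      then have "((\<lambda>x. exp (- \<i> * (of_real y * of_real x)) * (\<i> * of_real x) ^ a * exp (- ((of_real x)\<^sup>2 / 2))) has_vector_derivative g x) (at x)"
        by (rule has_vector_derivative_real_field)
      then show ?thesis
        unfolding hermite_kernel_def by (simp flip: exp_of_real)
    qed
    show "isCont g x" using cont by (simp add: continuous_on_eq_continuous_at)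
  next
    show "set_integrable lborel (einterval (-\<infinity>) \<infinity>) g" using g_int by (simp add: set_integrable_def)
    show "((hermite_kernel a y \<circ> real_of_ereal) \<longlongrightarrow> 0) (at_right (-\<infinity>))"
      using hermite_kernel_tendsto_0[of at_bot a y] by (simp add: ereal_tendsto_simps)
    show "((hermite_kernel a y \<circ> real_of_ereal) \<longlongrightarrow> 0) (at_left \<infinity>)"
      using hermite_kernel_tendsto_0[of at_top a y] by (simp add: ereal_tendsto_simps)
  qed simp
  then have "(\<integral>x. g x \<partial>lborel) = 0"
    by (simp add: interval_lebesgue_integral_def set_lebesgue_integral_def)
  then have "\<i> * (- of_real y * (\<integral>x. hermite_kernel a y x \<partial>lborel) + of_nat a * (\<integral>x. hermite_kernel (a - 1) y x \<partial>lborel)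
      + (\<integral>x. hermite_kernel (Suc a) y x \<partial>lborel)) = 0"
    unfolding g_def
    by (simp add: integrable_hermite_kernel algebra_simps)
  then show ?thesis by (simp add: add_eq_0_iff)
qed

lemma integral_hermite_kernel_0:
  "(\<integral>x. hermite_kernel 0 y x \<partial>lborel) = of_real (sqrt (2 * pi) * exp (- (y\<^sup>2 / 2)))"
proof -
  have "of_real (exp (- (y\<^sup>2 / 2))) = char std_normal_distribution (- y)"
    by (simp add: char_std_normal_distribution)
  also have "\<dots> = (\<integral>x. std_normal_density x *\<^sub>R exp (\<i> * of_real (- y * x)) \<partial>lborel)"
    unfolding char_def by (subst integral_density) auto
  also have "\<dots> = (\<integral>x. of_real (1 / sqrt (2 * pi)) * hermite_kernel 0 y x \<partial>lborel)"
    by (intro Bochner_Integration.integral_cong refl)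
      (simp add: hermite_kernel_def std_normal_density_def scaleR_conv_of_real)
  also have "\<dots> = of_real (1 / sqrt (2 * pi)) * (\<integral>x. hermite_kernel 0 y x \<partial>lborel)"
    by (rule integral_mult_right_zero)
  finally have "of_real (sqrt (2 * pi)) * of_real (exp (- (y\<^sup>2 / 2)))
     = of_real (sqrt (2 * pi)) * (of_real (1 / sqrt (2 * pi)) * (\<integral>x. hermite_kernel 0 y x \<partial>lborel))"
    by simp
  also have "\<dots> = (\<integral>x. hermite_kernel 0 y x \<partial>lborel)"
    by (simp add: mult.assoc[symmetric] flip: of_real_mult)
  finally show ?thesis by simp
qed

text \<open>Formally, the factor \<open>(\<i> * x) ^ a\<close> is the operator (- d/dy)^a applied to
  the transform of the Gaussian, which matches the sign in the definition of \<open>hermite\<close>.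
  Differentiation under the integral is replaced by a recurrence that both sides share, with equal
  values at 0 and 1.\<close>

lemma integral_hermite_kernel:
  "(\<integral>x. hermite_kernel a y x \<partial>lborel) = of_real (sqrt (2 * pi) * exp (- (y\<^sup>2 / 2)) * hermite a y)"
proof (induction a rule: induct_nat_012)
  case 1
  then show ?case
    using integral_hermite_kernel_Suc[of 0 y] by (simp add: hermite_Suc_0 integral_hermite_kernel_0)
next
  case (ge2 n)
  then show ?case
    using integral_hermite_kernel_Suc[of "Suc n" y] by (simp add: hermite_Suc_Suc algebra_simps)
qed (simp add: integral_hermite_kernel_0)

section \<open>Rescaling\<close>

lemma norm_vec_power2: "(norm x)\<^sup>2 = (\<Sum>j\<in>UNIV. (x $ j)\<^sup>2)" for x :: "real ^ 'd::finite"
  unfolding power2_norm_eq_inner inner_vec_def by (simp add: power2_eq_square)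

lemma integral_vec_scale:
  fixes f :: "real ^ 'd::finite \<Rightarrow> 'b::{banach,second_countable_topology}"
  assumes s: "\<And>j. s j > 0" and [measurable]: "f \<in> borel_measurable borel"
  shows "(\<integral>\<xi>. f \<xi> \<partial>lborel) = (\<Prod>j\<in>UNIV. s j) *\<^sub>R (\<integral>x. f (\<chi> j. s j * x $ j) \<partial>lborel)"
proof -
  define S :: "real ^ 'd" where "S = (\<chi> j. s j)"
  \<comment> \<open>Shaped after \<open>lborel_affine_euclidean\<close>, which is phrased with
    \<open>Basis\<close> vectors and a translation; hence the summand \<open>0\<close>.\<close>
  define T :: "real ^ 'd \<Rightarrow> real ^ 'd" where "T = (\<lambda>x. 0 + (\<Sum>b\<in>Basis. ((S \<bullet> b) * (x \<bullet> b)) *\<^sub>R b))"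
  have T: "T x = (\<chi> j. s j * x $ j)" for x
  proof -
    have "T x = (\<Sum>i\<in>UNIV. (s i * x $ i) *\<^sub>R axis i 1)"
      unfolding T_def sum_Basis_vec by (simp add: S_def inner_axis)
    then show ?thesis
      by (simp add: vec_eq_iff axis_def if_distrib[of "\<lambda>u. _ * u"] cong: if_cong)
  qed
  have T_meas [measurable]: "T \<in> borel_measurable borel"
    unfolding T_def by measurable
  have "lborel = density (distr lborel borel T) (\<lambda>_. ennreal (\<Prod>b\<in>Basis. \<bar>S \<bullet> b\<bar>))"
    unfolding T_def
  proof (subst lborel_affine_euclidean[of "\<lambda>b. S \<bullet> b" 0])
    show "S \<bullet> b \<noteq> 0" if "b \<in> Basis" for b
      using that s by (auto simp: Basis_vec_def S_def inner_axis less_imp_neq[symmetric])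
  qed simp
  moreover have "(\<Prod>b\<in>Basis. \<bar>S \<bullet> b\<bar>) = (\<Prod>j\<in>UNIV. s j)"
    using s by (simp add: prod_Basis_vec S_def inner_axis abs_of_pos)
  ultimately have "lborel = density (distr lborel borel T) (\<lambda>_. ennreal (\<Prod>j\<in>UNIV. s j))"
    by simp
  then have "(\<integral>\<xi>. f \<xi> \<partial>lborel) = (\<integral>\<xi>. f \<xi> \<partial>density (distr lborel borel T) (\<lambda>_. ennreal (\<Prod>j\<in>UNIV. s j)))"
    by simp
  also have "\<dots> = (\<integral>\<xi>. (\<Prod>j\<in>UNIV. s j) *\<^sub>R f \<xi> \<partial>distr lborel borel T)"
    using prod_nonneg[of UNIV s] s by (subst integral_density) (auto simp: less_imp_le)
  also have "\<dots> = (\<integral>x. (\<Prod>j\<in>UNIV. s j) *\<^sub>R f (T x) \<partial>lborel)"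
    by (subst integral_distr) auto
  also have "\<dots> = (\<Prod>j\<in>UNIV. s j) *\<^sub>R (\<integral>x. f (T x) \<partial>lborel)"
    by (rule integral_scaleR_right)
  finally show ?thesis unfolding T .
qed

section \<open>Monomials under scaling and their Gaussian transforms\<close>

lemma imonom_scale:
  "imonom \<alpha> (\<chi> j. x $ j / \<sigma> j) = imonom \<alpha> x / of_real (\<Prod>j\<in>UNIV. \<sigma> j ^ (\<alpha> $ j))"
proof -
  have "(\<i> * of_real ((\<chi> j. x $ j / \<sigma> j) $ j)) ^ (\<alpha> $ j)
    = (\<i> * of_real (x $ j)) ^ (\<alpha> $ j) / of_real (\<sigma> j ^ (\<alpha> $ j))" for j
    by (simp add: power_divide[symmetric])
  then show ?thesis
    unfolding imonom_def by (simp only: prod_dividef of_real_prod)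
qed

lemma imonom_scaleR:
  assumes "\<alpha> \<in> multi_indices s"
  shows "imonom \<alpha> (t *\<^sub>R x) = of_real (t ^ s) * imonom \<alpha> x"
proof -
  have "(\<Prod>j\<in>UNIV. (of_real t :: complex) ^ (\<alpha> $ j)) = of_real t ^ s"
    using assms by (simp add: multi_indices_def flip: power_sum)
  then show ?thesis
    by (simp add: imonom_def power_mult_distrib prod.distrib mult_ac)
qed

lemma norm_imonom_le:
  fixes x :: "real ^ 'd::finite"
  assumes "\<alpha> \<in> multi_indices s"
  shows "norm (imonom \<alpha> x) \<le> norm x ^ s"
proof -
  have "norm (imonom \<alpha> x) = (\<Prod>j\<in>UNIV. \<bar>x $ j\<bar> ^ (\<alpha> $ j))"
    unfolding imonom_def by (simp only: prod_norm[symmetric] norm_power norm_mult) simp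
  also have "\<dots> \<le> (\<Prod>j\<in>UNIV. norm x ^ (\<alpha> $ j))"
    by (intro prod_mono conjI power_mono component_le_norm_cart) auto
  also have "\<dots> = norm x ^ s"
    using assms by (simp add: multi_indices_def flip: power_sum)
  finally show ?thesis .
qed

lemma finite_multi_indices: "finite (multi_indices s :: (nat ^ 'd::finite) set)"
proof (rule finite_imageD)
  show "finite (vec_nth ` (multi_indices s :: (nat ^ 'd) set))"
  proof (rule finite_subset)
    show "vec_nth ` multi_indices s \<subseteq> Pi\<^sub>E (UNIV :: 'd set) (\<lambda>_. {..s})"
      by (auto simp: multi_indices_def intro: member_le_sum)
  qed (auto intro: finite_PiE)
  show "inj_on vec_nth (multi_indices s :: (nat ^ 'd) set)"
    by (auto simp: inj_on_def vec_eq_iff)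
qed

text \<open>The norm is Euclidean, so the Gaussian factorises along with the monomial and the wave;
  the multivariate transform reduces to \<open>integral_hermite_kernel\<close> in each
  coordinate.\<close>

lemma gaussian_imonom_eq_prod:
  "exp (- \<i> * of_real (\<Sum>j\<in>UNIV. y $ j * x $ j)) * (imonom \<alpha> x * of_real (exp (- ((norm x)\<^sup>2 / 2))))
     = (\<Prod>j\<in>UNIV. hermite_kernel (\<alpha> $ j) (y $ j) (x $ j))" for x :: "real ^ 'd::finite"
  unfolding hermite_kernel_def prod.distrib imonom_def norm_vec_power2
  by (simp add: sum_distrib_left sum_divide_distrib exp_sum sum_negf[symmetric] of_real_prod mult_ac
    del: sum_negf)

lemma integrable_gaussian_imonom:
  "integrable lborel (\<lambda>x :: real ^ 'd::finite.
     exp (- \<i> * of_real (\<Sum>j\<in>UNIV. y $ j * x $ j)) * (imonom \<alpha> x * of_real (exp (- ((norm x)\<^sup>2 / 2)))))"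
  unfolding gaussian_imonom_eq_prod by (intro integrable_prod_vec integrable_hermite_kernel)

lemma integral_gaussian_imonom:
  "(\<integral>x. exp (- \<i> * of_real (\<Sum>j\<in>UNIV. y $ j * x $ j)) *
      (imonom \<alpha> x * of_real (exp (- ((norm x)\<^sup>2 / 2)))) \<partial>lborel)
    = of_real (sqrt (2 * pi) ^ CARD('d) * exp (- ((norm y)\<^sup>2 / 2)) * multi_hermite \<alpha> y)"
  for y :: "real ^ 'd::finite"
proof -
  have "(\<Prod>j\<in>UNIV. exp (- ((y $ j)\<^sup>2 / 2))) = exp (- ((norm y)\<^sup>2 / 2))"
    by (simp add: norm_vec_power2 sum_divide_distrib exp_sum flip: sum_negf)
  then show ?thesis
    unfolding gaussian_imonom_eq_prod
    by (subst integral_prod_vec)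
      (simp_all add: integrable_hermite_kernel integral_hermite_kernel multi_hermite_def prod.distrib flip: of_real_prod)
qed

section \<open>Gaussian domination and the scaling limit of the exponent\<close>

lemma integrable_gaussian:
  assumes "a > 0"
  shows "integrable lborel (\<lambda>t::real. exp (- (a * t\<^sup>2)))"
proof -
  define s where "s = 1 / sqrt (2 * a)"
  have s: "s > 0" "1 / (2 * s\<^sup>2) = a" using assms by (auto simp: s_def power_divide)
  have "integrable lborel (\<lambda>t. sqrt (2 * pi * s\<^sup>2) * normal_density 0 s t)"
    by (intro integrable_mult_right integrable_normal_density s)
  moreover have "sqrt (2 * pi * s\<^sup>2) * normal_density 0 s t = exp (- (a * t\<^sup>2))" for t
    using s by (simp add: normal_density_def flip: s(2))
  ultimately show ?thesis by simp
qed

text \<open>Half of the exponent is given up to absorb the power. With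
  \<open>u = c / 2 * t\<^sup>2\<close>, one term of the exponential series bounds
  \<open>u ^ R\<close> by \<open>fact R * exp u\<close>; this controls \<open>t ^ (2 * R)\<close>,
  and \<open>t ^ R \<le> 1 + t ^ (2 * R)\<close>.\<close>

lemma power_gaussian_bounded:
  assumes c: "c > 0"
  obtains K where "K \<ge> 0" "\<And>t::real. t \<ge> 0 \<Longrightarrow> t ^ R * exp (- (c * t\<^sup>2)) \<le> K * exp (- (c / 2 * t\<^sup>2))"
proof -
  define K where "K = 1 + fact R / (c / 2) ^ R"
  show thesis
  proof
    show "K \<ge> 0" using c by (simp add: K_def)
    fix t :: real assume t: "t \<ge> 0"
    define u where "u = c / 2 * t\<^sup>2"
    have u: "u \<ge> 0" using c by (simp add: u_def)
    have "u ^ R / fact R \<le> exp u"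
    proof -
      have "u ^ R /\<^sub>R fact R \<le> (\<Sum>n. u ^ n /\<^sub>R fact n)"
        using sum_le_suminf[OF summable_exp_generic[of u], of "{R}"] u by simp
      then show ?thesis by (simp add: exp_def divide_inverse mult.commute)
    qed
    then have "t ^ (2 * R) * (c / 2) ^ R \<le> fact R * exp u"
      unfolding power_mult by (simp add: u_def power_mult_distrib field_simps)
    then have "t ^ (2 * R) \<le> fact R / (c / 2) ^ R * exp u"
      using c by (simp add: field_simps)
    moreover have "t ^ R \<le> 1 + t ^ (2 * R)"
    proof (cases "t \<le> 1")
      case True
      then have "t ^ R \<le> 1" using t by (simp add: power_le_one)
      moreover have "t ^ (2 * R) \<ge> 0" using t by simp
      ultimately show ?thesis by linarith
    next
      case False
      then have "t ^ R \<le> t ^ (2 * R)" by (intro power_increasing) auto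
      then show ?thesis by simp
    qed
    moreover have "1 \<le> exp u" using u by simp
    ultimately have "t ^ R \<le> exp u + fact R / (c / 2) ^ R * exp u" by linarith
    then have "t ^ R \<le> K * exp u" by (simp add: K_def distrib_right)
    then have "t ^ R * exp (- (2 * u)) \<le> K * exp u * exp (- (2 * u))"
      by (intro mult_right_mono) auto
    also have "\<dots> = K * exp (- u)" by (simp add: mult.assoc flip: exp_add)
    finally show "t ^ R * exp (- (c * t\<^sup>2)) \<le> K * exp (- (c / 2 * t\<^sup>2))" by (simp add: u_def)
  qed
qed

text \<open>With \<open>\<theta> = v / sqrt (l n)\<close> the prefactor is
  \<open>v\<^sup>2 / \<theta>\<^sup>2\<close>, exactly what an error of order
  \<open>o(\<theta>\<^sup>2)\<close> can bear. The case \<open>v = 0\<close> stands apart because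
  the filter \<open>at 0\<close> leaves out the point 0.\<close>

lemma reference_exponent_scaling_limit:
  assumes ref: "reference_exponent p f m \<sigma>" and l: "filterlim l at_top sequentially"
  shows "(\<lambda>n. of_real (l n) * (f (v / sqrt (l n)) - \<i> * of_real (m * (v / sqrt (l n)))))
    \<longlonglongrightarrow> - of_real (\<sigma>\<^sup>2 * v\<^sup>2 / 2)"
proof (cases "v = 0")
  case True
  have "f 0 = 0" using ref by (simp add: reference_exponent_def)
  with True show ?thesis by simp
next
  case False
  define h where "h = (\<lambda>\<theta>. f \<theta> - (\<i> * of_real (m * \<theta>) - of_real (\<sigma>\<^sup>2 * \<theta>\<^sup>2 / 2)))"
  have "h \<in> o[at 0](\<lambda>\<theta>. of_real (\<theta>\<^sup>2))"
    using ref unfolding reference_exponent_def h_def by simp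
  then have lim: "((\<lambda>\<theta>. h \<theta> / of_real (\<theta>\<^sup>2)) \<longlongrightarrow> 0) (at 0)"
    by (rule smalloD_tendsto)
  have pos: "\<forall>\<^sub>F n in sequentially. l n > 0"
    using l by (simp add: filterlim_at_top_dense)
  have sq: "filterlim (\<lambda>n. sqrt (l n)) at_top sequentially"
    by (rule filterlim_compose[OF sqrt_at_top l])
  have "filterlim (\<lambda>n. v / sqrt (l n)) (at 0) sequentially"
    unfolding filterlim_at
  proof
    show "(\<lambda>n. v / sqrt (l n)) \<longlonglongrightarrow> 0"
      by (rule tendsto_divide_0[OF tendsto_const filterlim_at_top_imp_at_infinity[OF sq]])
    show "\<forall>\<^sub>F n in sequentially. v / sqrt (l n) \<in> UNIV \<and> v / sqrt (l n) \<noteq> 0"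
      using pos by eventually_elim (use False in auto)
  qed
  from filterlim_compose[OF lim this]
  have "(\<lambda>n. of_real (v\<^sup>2) * (h (v / sqrt (l n)) / of_real ((v / sqrt (l n))\<^sup>2)) - of_real (\<sigma>\<^sup>2 * v\<^sup>2 / 2))
     \<longlonglongrightarrow> of_real (v\<^sup>2) * 0 - of_real (\<sigma>\<^sup>2 * v\<^sup>2 / 2)"
    by (intro tendsto_intros)
  moreover have "\<forall>\<^sub>F n in sequentially.
     of_real (v\<^sup>2) * (h (v / sqrt (l n)) / of_real ((v / sqrt (l n))\<^sup>2)) - of_real (\<sigma>\<^sup>2 * v\<^sup>2 / 2)
     = of_real (l n) * (f (v / sqrt (l n)) - \<i> * of_real (m * (v / sqrt (l n))))"
    using pos
  proof eventually_elim
    case (elim n)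
    define \<theta> where "\<theta> = v / sqrt (l n)"
    have \<theta>: "\<theta> \<noteq> 0" "v\<^sup>2 = l n * \<theta>\<^sup>2" using elim False by (auto simp: \<theta>_def power_divide)
    have "of_real (v\<^sup>2) * (h \<theta> / of_real (\<theta>\<^sup>2)) - of_real (\<sigma>\<^sup>2 * v\<^sup>2 / 2)
      = of_real (l n) * h \<theta> - of_real (l n) * of_real (\<sigma>\<^sup>2 * \<theta>\<^sup>2 / 2)"
      unfolding \<theta>(2) using \<theta>(1) by simp
    also have "\<dots> = of_real (l n) * (f \<theta> - \<i> * of_real (m * \<theta>))"
      by (simp add: h_def algebra_simps)
    finally show ?case unfolding \<theta>_def .
  qed
  ultimately show ?thesis
    by (auto dest: Lim_transform_eventually)
qed

text \<open>
  With \<open>R = r + 1\<close>, the limit of \<open>\<lambda>\<^sub>n\<^bsup>(R+d)/2\<^esup> (\<mu>\<^sub>n - \<nu>\<^sub>n)\<close> up to the factor \<open>\<Prod>\<^sub>i \<surd>(2\<pi>) \<sigma>\<^sub>i\<close>.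
\<close>

definition hermite_profile :: "('d::finite \<Rightarrow> real) \<Rightarrow> nat \<Rightarrow> (nat ^ 'd \<Rightarrow> complex) \<Rightarrow> real ^ 'd \<Rightarrow> complex" where
  "hermite_profile \<sigma> R \<beta> y = of_real (exp (- ((norm y)\<^sup>2 / 2))) *
     (\<Sum>\<alpha>\<in>multi_indices R. \<beta> \<alpha> * of_real (multi_hermite \<alpha> y) / of_real (\<Prod>i\<in>UNIV. \<sigma> i ^ (\<alpha> $ i)))"

text \<open>The pointwise limit of the rescaled inversion integrand. The coordinates are scaled to
  make the Gaussian standard, so the monomials see \<open>x $ j / \<sigma> j\<close>; this is the
  origin of the powers of \<open>\<sigma>\<close> in the denominators.\<close>

definition gaussian_profile :: "('d::finite \<Rightarrow> real) \<Rightarrow> nat \<Rightarrow> (nat ^ 'd \<Rightarrow> complex) \<Rightarrow> real ^ 'd \<Rightarrow> complex" where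
  "gaussian_profile \<sigma> R \<beta> x = of_real (exp (- ((norm x)\<^sup>2 / 2))) *
     (\<Sum>\<alpha>\<in>multi_indices R. \<beta> \<alpha> * imonom \<alpha> (\<chi> j. x $ j / \<sigma> j))"

text \<open>Opposite sign to \<open>wave\<close>, and a real frequency, since rescaled lattice
  points need not be integral.\<close>

abbreviation real_wave :: "real ^ 'd \<Rightarrow> real ^ 'd::finite \<Rightarrow> complex" where
  "real_wave y x \<equiv> exp (- \<i> * of_real (\<Sum>j\<in>UNIV. y $ j * x $ j))"

lemma norm_real_wave [simp]: "norm (real_wave y x) = 1"
  using norm_exp_i_times[of "- (\<Sum>j\<in>UNIV. y $ j * x $ j)"] by simp

lemma gaussian_profile_wave_eq:
  "real_wave y x * gaussian_profile \<sigma> R \<beta> x =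
    (\<Sum>\<alpha>\<in>multi_indices R. (\<beta> \<alpha> / of_real (\<Prod>i\<in>UNIV. \<sigma> i ^ (\<alpha> $ i))) *
       (real_wave y x * (imonom \<alpha> x * of_real (exp (- ((norm x)\<^sup>2 / 2))))))"
  unfolding gaussian_profile_def imonom_scale sum_distrib_left
  by (intro sum.cong refl) (simp only: divide_inverse mult_ac)

lemma integrable_gaussian_profile_wave:
  "integrable lborel (\<lambda>x. real_wave y x * gaussian_profile \<sigma> R \<beta> x)"
  unfolding gaussian_profile_wave_eq
  by (intro Bochner_Integration.integrable_sum integrable_mult_right integrable_gaussian_imonom)

lemma integrable_gaussian_profile: "integrable lborel (gaussian_profile \<sigma> R \<beta>)"
  using integrable_gaussian_profile_wave[of 0 \<sigma> R \<beta>] by simp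

lemma integral_gaussian_profile_wave:
  "(\<integral>x. real_wave y x * gaussian_profile \<sigma> R \<beta> x \<partial>lborel)
    = of_real (sqrt (2 * pi) ^ CARD('d)) * hermite_profile \<sigma> R \<beta> y" for y :: "real ^ 'd::finite"
proof -
  have "(\<integral>x. real_wave y x * gaussian_profile \<sigma> R \<beta> x \<partial>lborel)
    = (\<Sum>\<alpha>\<in>multi_indices R. (\<beta> \<alpha> / of_real (\<Prod>i\<in>UNIV. \<sigma> i ^ (\<alpha> $ i))) *
        of_real (sqrt (2 * pi) ^ CARD('d) * exp (- ((norm y)\<^sup>2 / 2)) * multi_hermite \<alpha> y))"
    unfolding gaussian_profile_wave_eq
    by (subst Bochner_Integration.integral_sum)
      (intro integrable_mult_right integrable_gaussian_imonom,
       simp only: integral_mult_right_zero integral_gaussian_imonom)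
  also have "\<dots> = of_real (sqrt (2 * pi) ^ CARD('d)) * hermite_profile \<sigma> R \<beta> y"
    unfolding hermite_profile_def sum_distrib_left of_real_mult
    by (intro sum.cong refl) (simp only: divide_inverse mult_ac)
  finally show ?thesis .
qed

text \<open>Read off from the Fourier representation: a transform is bounded by the L1 norm of the
  transformed function. Boundedness makes the real supremum of the profile meaningful.\<close>

lemma hermite_profile_bounded: "\<exists>B. \<forall>y. norm (hermite_profile \<sigma> R \<beta> y) \<le> B"
  for \<sigma> :: "'d::finite \<Rightarrow> real"
proof -
  define B where "B = (\<integral>x. norm (gaussian_profile \<sigma> R \<beta> x) \<partial>lborel)"
  have "norm (hermite_profile \<sigma> R \<beta> y) \<le> B" for y
  proof -
    \<comment> \<open>The factor is at least 1, so inserting it only weakens the bound and avoids a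
      division.\<close>
    have "1 \<le> sqrt (2 * pi) ^ CARD('d)"
      using pi_ge_two by (intro one_le_power) (auto simp: real_le_rsqrt)
    then have "norm (hermite_profile \<sigma> R \<beta> y) \<le> sqrt (2 * pi) ^ CARD('d) * norm (hermite_profile \<sigma> R \<beta> y)"
      by (metis mult_le_cancel_right1 norm_ge_zero mult.commute mult_right_mono mult_1)
    also have "\<dots> = norm (\<integral>x. real_wave y x * gaussian_profile \<sigma> R \<beta> x \<partial>lborel)"
      unfolding integral_gaussian_profile_wave by (simp add: norm_mult norm_power)
    also have "\<dots> \<le> (\<integral>x. norm (real_wave y x * gaussian_profile \<sigma> R \<beta> x) \<partial>lborel)"
      by (rule integral_norm_bound)
    also have "\<dots> = B" unfolding B_def norm_mult norm_real_wave by simp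
    finally show ?thesis .
  qed
  then show ?thesis by blast
qed

lemma continuous_hermite_profile: "continuous_on UNIV (hermite_profile \<sigma> R \<beta>)"
  unfolding hermite_profile_def multi_hermite_def divide_inverse
  by (intro continuous_intros)

text \<open>\<open>d\<close> stands for the value of a residue difference at the scaled point. The
  factor \<open>sqrt t ^ R\<close> undoes the scaling of the norm and \<open>t\<close> that of the
  quadratic bound, so \<open>K\<close> and \<open>c\<close> do not depend on
  \<open>t\<close>.\<close>

lemma rescaled_density_bound:
  fixes \<sigma> :: "'d::finite \<Rightarrow> real"
  assumes ref: "\<And>j. reference_exponent (p j) (\<phi> j) (m j) (\<sigma> j)" and C: "C \<ge> 0"
  obtains K c where "K \<ge> 0" "c > 0" "\<And>t v d. t > 0 \<Longrightarrow> (1 / sqrt t) *\<^sub>R v \<in> torus_cube \<Longrightarrow>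
      norm (d :: complex) \<le> C * norm ((1 / sqrt t) *\<^sub>R v) ^ R \<Longrightarrow>
      norm (of_real (sqrt t ^ R) * (exp (\<Sum>j\<in>UNIV. of_real t * (\<phi> j (v $ j / sqrt t) - \<i> * of_real (m j * (v $ j / sqrt t)))) * d))
       \<le> K * (\<Prod>j\<in>UNIV. exp (- (c * (v $ j)\<^sup>2)))"
proof -
  have "\<forall>j. \<exists>c>0. \<forall>\<theta>. \<bar>\<theta>\<bar> \<le> pi \<longrightarrow> Re (\<phi> j \<theta>) \<le> - c * \<theta>\<^sup>2"
    by (metis reference_exponent_Re_bound[OF ref])
  then obtain b where b: "\<And>j. b j > 0" "\<And>j \<theta>. \<bar>\<theta>\<bar> \<le> pi \<Longrightarrow> Re (\<phi> j \<theta>) \<le> - b j * \<theta>\<^sup>2"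
    by metis
  define c where "c = Min (range b)"
  have c: "c > 0" "\<And>j. c \<le> b j" using b(1) by (auto simp: c_def)
  obtain K where K: "K \<ge> 0" "\<And>t::real. t \<ge> 0 \<Longrightarrow> t ^ R * exp (- (c * t\<^sup>2)) \<le> K * exp (- (c / 2 * t\<^sup>2))"
    using power_gaussian_bounded[OF c(1)] by blast
  show thesis
  proof
    \<comment> \<open>The rate is halved because \<open>power_gaussian_bounded\<close> spends the
      other half on the power.\<close>
    show "C * K \<ge> 0" "c / 2 > 0" using C K c by auto
    fix t :: real and v :: "real ^ 'd" and d :: complex
    assume t: "t > 0" and v: "(1 / sqrt t) *\<^sub>R v \<in> torus_cube" and d: "norm d \<le> C * norm ((1 / sqrt t) *\<^sub>R v) ^ R"
    have "Re (of_real t * (\<phi> j (v $ j / sqrt t) - \<i> * of_real (m j * (v $ j / sqrt t)))) \<le> - (c * (v $ j)\<^sup>2)" for j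
    proof -
      have "- pi \<le> v $ j / sqrt t" "v $ j / sqrt t \<le> pi"
        using v by (auto simp: torus_cube_def mem_box_cart)
      then have "\<bar>v $ j / sqrt t\<bar> \<le> pi" by linarith
      from b(2)[OF this] have "t * Re (\<phi> j (v $ j / sqrt t)) \<le> t * (- b j * (v $ j / sqrt t)\<^sup>2)"
        using t by (intro mult_left_mono) auto
      also have "\<dots> = - b j * (v $ j)\<^sup>2" using t by (simp add: power_divide)
      also have "\<dots> \<le> - (c * (v $ j)\<^sup>2)" using mult_right_mono[OF c(2)[of j], of "(v $ j)\<^sup>2"] by simp
      finally show ?thesis by simp
    qed
    then have "Re (\<Sum>j\<in>UNIV. of_real t * (\<phi> j (v $ j / sqrt t) - \<i> * of_real (m j * (v $ j / sqrt t))))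
      \<le> (\<Sum>j\<in>UNIV. - (c * (v $ j)\<^sup>2))"
      unfolding Re_sum by (intro sum_mono)
    also have "\<dots> = - (c * (norm v)\<^sup>2)"
      by (simp add: norm_vec_power2 sum_distrib_left sum_negf)
    finally have "norm (exp (\<Sum>j\<in>UNIV. of_real t * (\<phi> j (v $ j / sqrt t) - \<i> * of_real (m j * (v $ j / sqrt t))))) \<le> exp (- (c * (norm v)\<^sup>2))"
      by simp
    moreover have "sqrt t ^ R * norm d \<le> C * norm v ^ R"
    proof -
      have "sqrt t ^ R * norm d \<le> sqrt t ^ R * (C * norm ((1 / sqrt t) *\<^sub>R v) ^ R)"
        using t by (intro mult_left_mono d) auto
      also have "\<dots> = C * (sqrt t * norm ((1 / sqrt t) *\<^sub>R v)) ^ R"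
        by (simp only: power_mult_distrib mult_ac)
      also have "sqrt t * norm ((1 / sqrt t) *\<^sub>R v) = norm v" using t by simp
      finally show ?thesis .
    qed
    ultimately have "norm (exp (\<Sum>j\<in>UNIV. of_real t * (\<phi> j (v $ j / sqrt t) - \<i> * of_real (m j * (v $ j / sqrt t))))) * (sqrt t ^ R * norm d)
        \<le> exp (- (c * (norm v)\<^sup>2)) * (C * norm v ^ R)"
      by (rule mult_mono) (use t in auto)
    also have "\<dots> = C * (norm v ^ R * exp (- (c * (norm v)\<^sup>2)))" by simp
    also have "\<dots> \<le> C * (K * exp (- (c / 2 * (norm v)\<^sup>2)))"
      by (intro mult_left_mono K C) simp
    \<comment> \<open>Back to a product over the coordinates, the form in which integrability is
      read off.\<close>
    also have "exp (- (c / 2 * (norm v)\<^sup>2)) = (\<Prod>j\<in>UNIV. exp (- (c / 2 * (v $ j)\<^sup>2)))"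
      by (simp add: norm_vec_power2 sum_distrib_left flip: exp_sum sum_negf)
    finally show "norm (of_real (sqrt t ^ R) * (exp (\<Sum>j\<in>UNIV. of_real t * (\<phi> j (v $ j / sqrt t) - \<i> * of_real (m j * (v $ j / sqrt t)))) * d))
       \<le> C * K * (\<Prod>j\<in>UNIV. exp (- (c / 2 * (v $ j)\<^sup>2)))"
      using t by (simp add: norm_mult norm_power mult_ac)
  qed
qed

section \<open>Convergence of the rescaled densities\<close>

text \<open>
  The inversion integrand at \<open>\<xi>\<^sub>j = x\<^sub>j / (\<sigma>\<^sub>j \<surd>t)\<close>; the drift \<open>\<i> t m\<^sub>j \<xi>\<^sub>j\<close> is left out, since
  it only shifts the frequency (see \<open>rescaled_point\<close>).
\<close>

definition rescaled_density ::
  "('d::finite \<Rightarrow> real \<Rightarrow> complex) \<Rightarrow> ('d \<Rightarrow> real) \<Rightarrow> ('d \<Rightarrow> real) \<Rightarrow> nat \<Rightarrow> real \<Rightarrow>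
   (real ^ 'd \<Rightarrow> complex) \<Rightarrow> real ^ 'd \<Rightarrow> complex" where
  "rescaled_density \<phi> m \<sigma> R t D x =
     (let v = (\<chi> j. x $ j / \<sigma> j) in
      indicator torus_cube ((1 / sqrt t) *\<^sub>R v) *\<^sub>R
       (of_real (sqrt t ^ R) *
         (exp (\<Sum>j\<in>UNIV. of_real t * (\<phi> j (v $ j / sqrt t) - \<i> * of_real (m j * (v $ j / sqrt t)))) *
          D ((1 / sqrt t) *\<^sub>R v))))"

text \<open>The origin is excluded because the expansion of the residues lives on a punctured
  neighbourhood; a single point is null for the later integral.\<close>

lemma rescaled_density_tendsto:
  fixes \<sigma> :: "'d::finite \<Rightarrow> real"
  assumes ref: "\<And>j. reference_exponent (p j) (\<phi> j) (m j) (\<sigma> j)"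
    and l: "filterlim l at_top sequentially"
    and D: "\<And>v. v \<noteq> 0 \<Longrightarrow> (\<lambda>n. of_real (sqrt (l n) ^ R) * D n ((1 / sqrt (l n)) *\<^sub>R v))
          \<longlonglongrightarrow> (\<Sum>\<alpha>\<in>multi_indices R. \<beta> \<alpha> * imonom \<alpha> v)"
    and x: "x \<noteq> 0"
  shows "(\<lambda>n. rescaled_density \<phi> m \<sigma> R (l n) (D n) x) \<longlonglongrightarrow> gaussian_profile \<sigma> R \<beta> x"
proof -
  have \<sigma>: "\<sigma> j > 0" for j using ref[of j] by (simp add: reference_exponent_def)
  define v :: "real ^ 'd" where "v = (\<chi> j. x $ j / \<sigma> j)"
  have "v \<noteq> 0" using x \<sigma> by (auto simp: v_def vec_eq_iff less_imp_neq[symmetric])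
  have "filterlim (\<lambda>n. sqrt (l n)) at_top sequentially"
    by (rule filterlim_compose[OF sqrt_at_top l])
  then have "(\<lambda>n. v $ j / sqrt (l n)) \<longlonglongrightarrow> 0" for j
    by (intro tendsto_divide_0[OF tendsto_const] filterlim_at_top_imp_at_infinity)
  then have "\<forall>\<^sub>F n in sequentially. \<bar>v $ j / sqrt (l n)\<bar> < pi" for j
    by (rule order_tendstoD(2)[OF tendsto_rabs_zero pi_gt_zero])
  then have "\<forall>\<^sub>F n in sequentially. \<forall>j. \<bar>v $ j / sqrt (l n)\<bar> < pi"
    by (rule eventually_all_finite)
  \<comment> \<open>The rescaled cubes exhaust the space, so the indicator is eventually 1 at a
    fixed point.\<close>
  then have cube: "\<forall>\<^sub>F n in sequentially. (1 / sqrt (l n)) *\<^sub>R v \<in> torus_cube"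
  proof eventually_elim
    case (elim n)
    have "- pi \<le> v $ j / sqrt (l n) \<and> v $ j / sqrt (l n) \<le> pi" for j
      using elim[rule_format, of j] by linarith
    then show ?case by (simp add: torus_cube_def mem_box_cart)
  qed
  have lim: "(\<lambda>n. exp (\<Sum>j\<in>UNIV. of_real (l n) * (\<phi> j (v $ j / sqrt (l n)) - \<i> * of_real (m j * (v $ j / sqrt (l n))))) *
      (of_real (sqrt (l n) ^ R) * D n ((1 / sqrt (l n)) *\<^sub>R v)))
    \<longlonglongrightarrow> exp (\<Sum>j\<in>UNIV. - of_real ((\<sigma> j)\<^sup>2 * (v $ j)\<^sup>2 / 2)) * (\<Sum>\<alpha>\<in>multi_indices R. \<beta> \<alpha> * imonom \<alpha> v)"
    by (intro tendsto_mult tendsto_exp tendsto_sum reference_exponent_scaling_limit[OF ref l] D \<open>v \<noteq> 0\<close>)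
  \<comment> \<open>Division by \<open>\<sigma> j\<close> was chosen for this: the variances cancel
    and the Gaussian is standard.\<close>
  have "(\<Sum>j\<in>UNIV. - complex_of_real ((\<sigma> j)\<^sup>2 * (v $ j)\<^sup>2 / 2)) = of_real (- ((norm x)\<^sup>2 / 2))"
  proof -
    have "(\<sigma> j)\<^sup>2 * (v $ j)\<^sup>2 = (x $ j)\<^sup>2" for j
      using \<sigma>[of j] by (simp add: v_def power_divide)
    then show ?thesis
      by (simp add: norm_vec_power2 sum_negf sum_divide_distrib)
  qed
  then have "exp (\<Sum>j\<in>UNIV. - complex_of_real ((\<sigma> j)\<^sup>2 * (v $ j)\<^sup>2 / 2)) * (\<Sum>\<alpha>\<in>multi_indices R. \<beta> \<alpha> * imonom \<alpha> v)
     = gaussian_profile \<sigma> R \<beta> x"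
    by (simp only: gaussian_profile_def exp_of_real v_def)
  note lim = lim[unfolded this]
  show ?thesis
  proof (rule Lim_transform_eventually[OF lim])
    show "\<forall>\<^sub>F n in sequentially. exp (\<Sum>j\<in>UNIV. of_real (l n) * (\<phi> j (v $ j / sqrt (l n)) - \<i> * of_real (m j * (v $ j / sqrt (l n))))) *
      (of_real (sqrt (l n) ^ R) * D n ((1 / sqrt (l n)) *\<^sub>R v)) = rescaled_density \<phi> m \<sigma> R (l n) (D n) x"
      using cube by eventually_elim (simp add: rescaled_density_def Let_def flip: v_def)
  qed
qed

lemma rescaled_density_measurable:
  assumes "\<And>j. continuous_on UNIV (\<phi> j)" "continuous_on UNIV D"
  shows "rescaled_density \<phi> m \<sigma> R t D \<in> borel_measurable borel"
proof -
  have [measurable]: "D \<in> borel_measurable borel" "\<And>j. \<phi> j \<in> borel_measurable borel"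
    using assms by (auto intro: borel_measurable_continuous_onI)
  have "continuous_on UNIV (\<lambda>x::real ^ 'a. (1 / sqrt t) *\<^sub>R (\<chi> j. x $ j / \<sigma> j))"
    unfolding divide_inverse by (intro continuous_intros)
  then have [measurable]: "(\<lambda>x::real ^ 'a. (1 / sqrt t) *\<^sub>R (\<chi> j. x $ j / \<sigma> j)) \<in> borel_measurable borel"
    by (rule borel_measurable_continuous_onI)
  show ?thesis
    unfolding rescaled_density_def Let_def vec_lambda_beta by measurable
qed

lemma rescaled_density_L1:
  fixes \<sigma> :: "'d::finite \<Rightarrow> real"
  assumes ref: "\<And>j. reference_exponent (p j) (\<phi> j) (m j) (\<sigma> j)"
    and l: "filterlim l at_top sequentially"
    and cont: "\<And>n. continuous_on UNIV (D n)"
    and D: "\<And>v. v \<noteq> 0 \<Longrightarrow> (\<lambda>n. of_real (sqrt (l n) ^ R) * D n ((1 / sqrt (l n)) *\<^sub>R v))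
          \<longlonglongrightarrow> (\<Sum>\<alpha>\<in>multi_indices R. \<beta> \<alpha> * imonom \<alpha> v)"
    and C: "C \<ge> 0" "\<forall>\<^sub>F n in sequentially. \<forall>\<xi>\<in>torus_cube. norm (D n \<xi>) \<le> C * norm \<xi> ^ R"
  shows "\<forall>\<^sub>F n in sequentially. integrable lborel (rescaled_density \<phi> m \<sigma> R (l n) (D n))"
    and "(\<lambda>n. \<integral>x. norm (rescaled_density \<phi> m \<sigma> R (l n) (D n) x - gaussian_profile \<sigma> R \<beta> x) \<partial>lborel) \<longlonglongrightarrow> 0"
proof -
  have \<sigma>: "\<sigma> j > 0" for j using ref[of j] by (simp add: reference_exponent_def)
  have cont_\<phi>: "continuous_on UNIV (\<phi> j)" for j using ref[of j] by (simp add: reference_exponent_def)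
  let ?G = "\<lambda>n. rescaled_density \<phi> m \<sigma> R (l n) (D n)"
  have meas [measurable]: "?G n \<in> borel_measurable borel" for n
    by (rule rescaled_density_measurable[OF cont_\<phi> cont])
  obtain K c where K: "K \<ge> 0" "c > 0" "\<And>t v d. t > 0 \<Longrightarrow> (1 / sqrt t) *\<^sub>R v \<in> torus_cube \<Longrightarrow>
      norm (d :: complex) \<le> C * norm ((1 / sqrt t) *\<^sub>R v) ^ R \<Longrightarrow>
      norm (of_real (sqrt t ^ R) * (exp (\<Sum>j\<in>UNIV. of_real t * (\<phi> j (v $ j / sqrt t) - \<i> * of_real (m j * (v $ j / sqrt t)))) * d))
       \<le> K * (\<Prod>j\<in>UNIV. exp (- (c * (v $ j)\<^sup>2)))"
    by (rule rescaled_density_bound[where R=R, OF ref C(1)]) (rule that)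
  \<comment> \<open>The bound is stated in \<open>v\<close>; substituting
    \<open>x $ j / \<sigma> j\<close> puts the variances into the rates.\<close>
  define w where "w = (\<lambda>x::real ^ 'd. K * (\<Prod>j\<in>UNIV. exp (- (c / (\<sigma> j)\<^sup>2 * (x $ j)\<^sup>2))))"
  have w_int: "integrable lborel w"
  proof -
    have "c / (\<sigma> j)\<^sup>2 > 0" for j
      using K(2) \<sigma>[of j] by simp
    then show ?thesis
      unfolding w_def by (intro integrable_mult_right integrable_prod_vec integrable_gaussian)
  qed
  have "\<forall>\<^sub>F n in sequentially. l n > 0" using l by (simp add: filterlim_at_top_dense)
  with C(2) have "\<forall>\<^sub>F n in sequentially. \<forall>x. norm (?G n x) \<le> w x"
  proof eventually_elim
    case (elim n)
    show ?case
    proof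
      fix x :: "real ^ 'd"
      define v :: "real ^ 'd" where "v = (\<chi> j. x $ j / \<sigma> j)"
      have w_eq: "K * (\<Prod>j\<in>UNIV. exp (- (c * (v $ j)\<^sup>2))) = w x"
        by (simp add: w_def v_def power_divide)
      show "norm (?G n x) \<le> w x"
      proof (cases "(1 / sqrt (l n)) *\<^sub>R v \<in> torus_cube")
        case True
        from K(3)[OF elim(2) True elim(1)[rule_format, OF True]] show ?thesis
          unfolding w_eq unfolding rescaled_density_def Let_def v_def[symmetric] using True by simp
      next
        case False
        have "w x \<ge> 0" unfolding w_def using K(1) by (intro mult_nonneg_nonneg prod_nonneg) auto
        then show ?thesis
          unfolding rescaled_density_def Let_def v_def[symmetric] using False by simp
      qed
    qed
  qed
  then obtain N where N: "\<And>n x. n \<ge> N \<Longrightarrow> norm (?G n x) \<le> w x"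
    by (auto simp: eventually_sequentially)
  have int: "integrable lborel (?G n)" if "n \<ge> N" for n
  proof (rule Bochner_Integration.integrable_bound[OF w_int])
    show "AE x in lborel. norm (?G n x) \<le> norm (w x)"
    proof (rule AE_I2)
      show "norm (?G n x) \<le> norm (w x)" for x
        using N[OF that, of x] by simp
    qed
  qed simp
  then show "\<forall>\<^sub>F n in sequentially. integrable lborel (?G n)"
    by (auto simp: eventually_sequentially)
  have P_int: "integrable lborel (gaussian_profile \<sigma> R \<beta>)" by (rule integrable_gaussian_profile)
  then have [measurable]: "gaussian_profile \<sigma> R \<beta> \<in> borel_measurable borel"
    using borel_measurable_integrable by fastforce
  \<comment> \<open>Domination is known from index \<open>N\<close> on, so dominated convergence is
    applied to the shifted sequence.\<close>
  have "(\<lambda>n. \<integral>x. norm (?G (n + N) x - gaussian_profile \<sigma> R \<beta> x) \<partial>lborel) \<longlonglongrightarrow> (\<integral>x. 0 \<partial>(lborel :: (real ^ 'd) measure))"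
  proof (rule integral_dominated_convergence)
    show "integrable lborel (\<lambda>x. w x + norm (gaussian_profile \<sigma> R \<beta> x))"
      using w_int P_int by auto
    show "AE x in lborel. (\<lambda>n. norm (?G (n + N) x - gaussian_profile \<sigma> R \<beta> x)) \<longlonglongrightarrow> 0"
      using AE_lborel_singleton[of 0]
    proof eventually_elim
      case (elim x)
      have "(\<lambda>n. ?G n x) \<longlonglongrightarrow> gaussian_profile \<sigma> R \<beta> x"
        using rescaled_density_tendsto[OF ref l D elim] .
      then have "(\<lambda>n. ?G (n + N) x) \<longlonglongrightarrow> gaussian_profile \<sigma> R \<beta> x"
        by (rule LIMSEQ_ignore_initial_segment)
      then show ?case by (intro tendsto_norm_zero LIM_zero)
    qed
    show "AE x in lborel. norm (norm (?G (n + N) x - gaussian_profile \<sigma> R \<beta> x)) \<le> w x + norm (gaussian_profile \<sigma> R \<beta> x)" for n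
    proof (rule AE_I2)
      show "norm (norm (?G (n + N) x - gaussian_profile \<sigma> R \<beta> x)) \<le> w x + norm (gaussian_profile \<sigma> R \<beta> x)" for x
        using norm_triangle_ineq4[of "?G (n + N) x" "gaussian_profile \<sigma> R \<beta> x"] N[of "n + N" x] by simp
    qed
  qed auto
  then show "(\<lambda>n. \<integral>x. norm (?G n x - gaussian_profile \<sigma> R \<beta> x) \<partial>lborel) \<longlonglongrightarrow> 0"
    unfolding Bochner_Integration.integral_zero by (rule LIMSEQ_offset)
qed

section \<open>Standardised lattice points and the uniform local limit\<close>

definition rescaled_point :: "('d::finite \<Rightarrow> real) \<Rightarrow> ('d \<Rightarrow> real) \<Rightarrow> real \<Rightarrow> int ^ 'd \<Rightarrow> real ^ 'd" where
  "rescaled_point m \<sigma> t k = (\<chi> j. (of_int (k $ j) - t * m j) / (\<sigma> j * sqrt t))"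

text \<open>The product of the \<open>\<sigma> j\<close> and \<open>sqrt t ^ CARD('d)\<close> cancel
  the Jacobian, while \<open>sqrt t ^ R\<close> is the normalisation inside the density.
  \<open>rescaled_point\<close> is \<open>k\<close> standardised by mean \<open>t * m j\<close> and
  deviation \<open>\<sigma> j * sqrt t\<close>: the frequency left once drift and character are
  merged.\<close>

lemma integral_rescaled_density:
  fixes \<sigma> :: "'d::finite \<Rightarrow> real"
  assumes \<sigma>: "\<And>j. \<sigma> j > 0" and t: "t > 0"
    and cont: "\<And>j. continuous_on UNIV (\<phi> j)" "continuous_on UNIV D"
  shows "of_real ((\<Prod>j\<in>UNIV. \<sigma> j) * sqrt t ^ (R + CARD('d))) *
      (\<integral>\<xi>. indicator torus_cube \<xi> *\<^sub>R (exp (of_real t * total_exponent \<phi> \<xi>) * D \<xi> * wave (- k) \<xi>) \<partial>lborel)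
    = (\<integral>x. real_wave (rescaled_point m \<sigma> t k) x * rescaled_density \<phi> m \<sigma> R t D x \<partial>lborel)"
proof -
  define s where "s = (\<lambda>j. 1 / (\<sigma> j * sqrt t))"
  define f where "f = (\<lambda>\<xi>::real ^ 'd. indicator torus_cube \<xi> *\<^sub>R (exp (of_real t * total_exponent \<phi> \<xi>) * D \<xi> * wave (- k) \<xi>))"
  have [measurable]: "D \<in> borel_measurable borel" "\<And>j. \<phi> j \<in> borel_measurable borel"
    using cont by (auto intro: borel_measurable_continuous_onI)
  have f_meas: "f \<in> borel_measurable borel"
    unfolding f_def total_exponent_def by measurable
  have s: "s j > 0" for j using \<sigma> t by (simp add: s_def)
  have prod_s: "(\<Prod>j\<in>UNIV. \<sigma> j) * sqrt t ^ CARD('d) * (\<Prod>j\<in>UNIV. s j) = 1"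
  proof -
    have "(\<Prod>j\<in>UNIV. \<sigma> j) * sqrt t ^ CARD('d) * (\<Prod>j\<in>UNIV. s j) = (\<Prod>j\<in>UNIV. \<sigma> j * sqrt t * s j)"
      by (simp add: prod.distrib)
    also have "\<dots> = 1" using \<sigma> t by (intro prod.neutral) (simp add: s_def less_imp_neq[symmetric])
    finally show ?thesis .
  qed
  have integrand: "of_real (sqrt t ^ R) * f (\<chi> j. s j * x $ j) = real_wave (rescaled_point m \<sigma> t k) x * rescaled_density \<phi> m \<sigma> R t D x" for x
  proof -
    define v :: "real ^ 'd" where "v = (\<chi> j. x $ j / \<sigma> j)"
    define \<xi> where "\<xi> = (1 / sqrt t) *\<^sub>R v"
    have \<xi>: "(\<chi> j. s j * x $ j) = \<xi>" by (simp add: s_def \<xi>_def v_def vec_eq_iff)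
    have \<xi>_nth: "v $ j / sqrt t = \<xi> $ j" for j by (simp add: \<xi>_def)
    \<comment> \<open>The drift is subtracted from the exponent and put back into the linear term,
      where it meets the \<open>- k\<close> of the character.\<close>
    have "of_real t * total_exponent \<phi> \<xi> + \<i> * of_real (\<Sum>j\<in>UNIV. of_int ((- k) $ j) * \<xi> $ j)
      = (\<Sum>j\<in>UNIV. of_real t * (\<phi> j (\<xi> $ j) - \<i> * of_real (m j * \<xi> $ j)) - \<i> * of_real ((of_int (k $ j) - t * m j) * \<xi> $ j))"
      unfolding total_exponent_def of_real_sum sum_distrib_left sum.distrib[symmetric]
      by (intro sum.cong refl) (simp add: algebra_simps)
    also have "\<dots> = (\<Sum>j\<in>UNIV. of_real t * (\<phi> j (\<xi> $ j) - \<i> * of_real (m j * \<xi> $ j)))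
        + (- \<i> * of_real (\<Sum>j\<in>UNIV. rescaled_point m \<sigma> t k $ j * x $ j))"
    proof -
      have "(of_int (k $ j) - t * m j) * \<xi> $ j = rescaled_point m \<sigma> t k $ j * x $ j" for j
        by (simp add: rescaled_point_def \<xi>_def v_def)
      then show ?thesis by (simp add: sum_subtractf sum_distrib_left sum_negf)
    qed
    finally have "exp (of_real t * total_exponent \<phi> \<xi>) * wave (- k) \<xi> =
       exp (\<Sum>j\<in>UNIV. of_real t * (\<phi> j (\<xi> $ j) - \<i> * of_real (m j * \<xi> $ j))) * real_wave (rescaled_point m \<sigma> t k) x"
      unfolding exp_add[symmetric] by simp
    then have "of_real (sqrt t ^ R) * (indicator torus_cube \<xi> *\<^sub>R (D \<xi> * (exp (of_real t * total_exponent \<phi> \<xi>) * wave (- k) \<xi>)))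
      = real_wave (rescaled_point m \<sigma> t k) x * (indicator torus_cube \<xi> *\<^sub>R (of_real (sqrt t ^ R) * (exp (\<Sum>j\<in>UNIV. of_real t * (\<phi> j (\<xi> $ j) - \<i> * of_real (m j * \<xi> $ j))) * D \<xi>)))"
      by (simp only: scaleR_conv_of_real mult_ac)
    then show ?thesis
      unfolding rescaled_density_def Let_def v_def[symmetric] \<xi> f_def \<xi>_def[symmetric] \<xi>_nth
      by (simp only: mult_ac)
  qed
  have "of_real ((\<Prod>j\<in>UNIV. \<sigma> j) * sqrt t ^ (R + CARD('d))) * (\<integral>\<xi>. f \<xi> \<partial>lborel)
    = of_real ((\<Prod>j\<in>UNIV. \<sigma> j) * sqrt t ^ CARD('d) * (\<Prod>j\<in>UNIV. s j)) * (of_real (sqrt t ^ R) * (\<integral>x. f (\<chi> j. s j * x $ j) \<partial>lborel))"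
  proof -
    have "(\<integral>\<xi>. f \<xi> \<partial>lborel) = of_real (\<Prod>j\<in>UNIV. s j) * (\<integral>x. f (\<chi> j. s j * x $ j) \<partial>lborel)"
      unfolding scaleR_conv_of_real[symmetric] by (rule integral_vec_scale[OF s f_meas])
    then show ?thesis
      by (simp only: power_add of_real_mult mult_ac)
  qed
  also have "\<dots> = (\<integral>x. of_real (sqrt t ^ R) * f (\<chi> j. s j * x $ j) \<partial>lborel)"
    unfolding prod_s by simp
  finally show ?thesis unfolding integrand unfolding f_def .
qed

text \<open>Up to a constant the error is a Fourier transform evaluated at
  \<open>rescaled_point\<close>, hence bounded by the L1 distance of the integrands, in which
  \<open>k\<close> no longer occurs.\<close>

lemma local_limit_uniform:
  fixes \<sigma> :: "'d::finite \<Rightarrow> real" and a :: "nat \<Rightarrow> int ^ 'd \<Rightarrow> real"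
  assumes ref: "\<And>j. reference_exponent (p j) (\<phi> j) (m j) (\<sigma> j)"
    and l: "filterlim l at_top sequentially"
    and cont: "\<And>n. continuous_on UNIV (D n)"
    and D: "\<And>v. v \<noteq> 0 \<Longrightarrow> (\<lambda>n. of_real (sqrt (l n) ^ R) * D n ((1 / sqrt (l n)) *\<^sub>R v))
          \<longlonglongrightarrow> (\<Sum>\<alpha>\<in>multi_indices R. \<beta> \<alpha> * imonom \<alpha> v)"
    and C: "C \<ge> 0" "\<forall>\<^sub>F n in sequentially. \<forall>\<xi>\<in>torus_cube. norm (D n \<xi>) \<le> C * norm \<xi> ^ R"
    and inversion: "\<And>n k. (2 * of_real pi) ^ CARD('d) * of_real (a n k) =
      (\<integral>\<xi>. indicator torus_cube \<xi> *\<^sub>R (exp (of_real (l n) * total_exponent \<phi> \<xi>) * D n \<xi> * wave (- k) \<xi>) \<partial>lborel)"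
    and e: "e > 0"
  shows "\<forall>\<^sub>F n in sequentially. \<forall>k.
    norm (of_real ((\<Prod>i\<in>UNIV. sqrt (2 * pi) * \<sigma> i) * sqrt (l n) ^ (R + CARD('d)) * a n k)
      - hermite_profile \<sigma> R \<beta> (rescaled_point m \<sigma> (l n) k)) \<le> e"
proof -
  have \<sigma>: "\<sigma> j > 0" for j using ref[of j] by (simp add: reference_exponent_def)
  have cont_\<phi>: "continuous_on UNIV (\<phi> j)" for j using ref[of j] by (simp add: reference_exponent_def)
  have int: "\<forall>\<^sub>F n in sequentially. integrable lborel (rescaled_density \<phi> m \<sigma> R (l n) (D n))"
    by (rule rescaled_density_L1(1)[where p=p, OF ref l cont _ C]) (rule D)
  have L1: "(\<lambda>n. \<integral>x. norm (rescaled_density \<phi> m \<sigma> R (l n) (D n) x - gaussian_profile \<sigma> R \<beta> x) \<partial>lborel) \<longlonglongrightarrow> 0"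
    by (rule rescaled_density_L1(2)[where p=p, OF ref l cont _ C]) (rule D)
  have "\<forall>\<^sub>F n in sequentially. l n > 0" using l by (simp add: filterlim_at_top_dense)
  with int order_tendstoD(2)[OF L1 e] show ?thesis
  proof eventually_elim
    case (elim n)
    let ?G = "rescaled_density \<phi> m \<sigma> R (l n) (D n)" and ?P = "gaussian_profile \<sigma> R \<beta>"
    \<comment> \<open>The factor \<open>(2 * pi) ^ CARD('d)\<close> of the inversion is
      \<open>W * W\<close>: one copy belongs to the normalisation of \<open>a n k\<close>, the other
      to the transform of the Gaussian profile. The latter is dropped at the end by
      \<open>W \<ge> 1\<close>.\<close>
    define W where "W = sqrt (2 * pi) ^ CARD('d)"
    have W1: "W \<ge> 1"
      using pi_ge_two unfolding W_def by (intro one_le_power) (auto simp: real_le_rsqrt)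
    have W2: "W * W = (2 * pi) ^ CARD('d)"
      unfolding W_def power_mult_distrib[symmetric] by simp
    have W': "complex_of_real W * of_real W = (2 * of_real pi) ^ CARD('d)"
      unfolding of_real_mult[symmetric] W2 by simp
    show ?case
    proof
      fix k :: "int ^ 'd"
      let ?y = "rescaled_point m \<sigma> (l n) k"
      let ?A = "complex_of_real ((\<Prod>i\<in>UNIV. sqrt (2 * pi) * \<sigma> i) * sqrt (l n) ^ (R + CARD('d)) * a n k)"
      have "continuous_on UNIV (real_wave ?y)" by (intro continuous_intros)
      then have "real_wave ?y \<in> borel_measurable borel"
        by (rule borel_measurable_continuous_onI)
      have int_G: "integrable lborel (\<lambda>x. real_wave ?y x * ?G x)"
      proof (rule Bochner_Integration.integrable_bound[OF elim(1)])
        have "?G \<in> borel_measurable borel"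
          by (rule rescaled_density_measurable[OF cont_\<phi> cont])
        show "(\<lambda>x. real_wave ?y x * ?G x) \<in> borel_measurable lborel"
          unfolding measurable_lborel2 by (intro borel_measurable_times) fact+
      qed (rule AE_I2, simp only: norm_mult norm_real_wave mult_1 order_refl)
      have "?A = of_real W * (of_real ((\<Prod>j\<in>UNIV. \<sigma> j) * sqrt (l n) ^ (R + CARD('d))) * of_real (a n k))"
        unfolding prod.distrib prod_constant W_def of_real_mult by (simp only: mult_ac)
      then have "of_real W * ?A = of_real ((\<Prod>j\<in>UNIV. \<sigma> j) * sqrt (l n) ^ (R + CARD('d))) * ((of_real W * of_real W) * of_real (a n k))"
        by (simp only: mult_ac)
      also have "\<dots> = (\<integral>x. real_wave ?y x * ?G x \<partial>lborel)"
        unfolding W' inversion by (rule integral_rescaled_density[OF \<sigma> elim(3) cont_\<phi> cont])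
      finally have "of_real W * (?A - hermite_profile \<sigma> R \<beta> ?y) =
          (\<integral>x. real_wave ?y x * ?G x \<partial>lborel) - (\<integral>x. real_wave ?y x * ?P x \<partial>lborel)"
        unfolding integral_gaussian_profile_wave W_def[symmetric] by (simp only: right_diff_distrib)
      also have "\<dots> = (\<integral>x. real_wave ?y x * ?G x - real_wave ?y x * ?P x \<partial>lborel)"
        by (rule Bochner_Integration.integral_diff[symmetric, OF int_G integrable_gaussian_profile_wave])
      also have "\<dots> = (\<integral>x. real_wave ?y x * (?G x - ?P x) \<partial>lborel)"
        by (simp only: right_diff_distrib)
      finally have *: "of_real W * (?A - hermite_profile \<sigma> R \<beta> ?y) = (\<integral>x. real_wave ?y x * (?G x - ?P x) \<partial>lborel)" .
      have "norm (?A - hermite_profile \<sigma> R \<beta> ?y) \<le> W * norm (?A - hermite_profile \<sigma> R \<beta> ?y)"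
        using mult_right_mono[OF W1, of "norm (?A - hermite_profile \<sigma> R \<beta> ?y)"] by simp
      also have "\<dots> = norm (\<integral>x. real_wave ?y x * (?G x - ?P x) \<partial>lborel)"
        unfolding *[symmetric] norm_mult using W1 by simp
      also have "\<dots> \<le> (\<integral>x. norm (real_wave ?y x * (?G x - ?P x)) \<partial>lborel)"
        by (rule integral_norm_bound)
      also have "\<dots> = (\<integral>x. norm (?G x - ?P x) \<partial>lborel)"
        by (simp only: norm_mult norm_real_wave mult_1)
      also have "\<dots> \<le> e" using elim(2) by simp
      finally show "norm (?A - hermite_profile \<sigma> R \<beta> ?y) \<le> e" .
    qed
  qed
qed

text \<open>Above, each \<open>b n k\<close> is within the error of some value of \<open>F\<close>.
  Below, samples approach a near-maximiser of \<open>F\<close>, and continuity at that one point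
  carries the estimate.\<close>

lemma SUP_tendsto_of_uniform:
  fixes b :: "nat \<Rightarrow> 'k \<Rightarrow> real" and F :: "'x::t2_space \<Rightarrow> real"
  assumes cont: "continuous_on UNIV F" and bdd: "bdd_above (range F)"
    and close: "\<And>e. e > 0 \<Longrightarrow> \<forall>\<^sub>F n in sequentially. \<forall>k. \<bar>b n k - F (y n k)\<bar> \<le> e"
    and dense: "\<And>x. \<exists>\<kappa>. (\<lambda>n. y n (\<kappa> n)) \<longlonglongrightarrow> x"
  shows "(\<lambda>n. SUP k. b n k) \<longlonglongrightarrow> (SUP x. F x)"
proof (rule tendstoI)
  fix e :: real assume e: "e > 0"
  define S where "S = (SUP x. F x)"
  have F_le: "F x \<le> S" for x unfolding S_def by (rule cSUP_upper[OF _ bdd]) simp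
  \<comment> \<open>One third of \<open>e\<close> pays for the near-maximiser, one for the uniform
    error. The strict inequality passes to the samples by continuity at no further cost.\<close>
  have "S - e / 3 < S" using e by simp
  then obtain x where x: "F x > S - e / 3"
    unfolding S_def by (subst (asm) less_cSUP_iff[OF _ bdd]) auto
  obtain \<kappa> where \<kappa>: "(\<lambda>n. y n (\<kappa> n)) \<longlonglongrightarrow> x" using dense by blast
  have "isCont F x" using cont by (simp add: continuous_on_eq_continuous_at)
  then have "(\<lambda>n. F (y n (\<kappa> n))) \<longlonglongrightarrow> F x"
    using \<kappa> by (rule isCont_tendsto_compose)
  from order_tendstoD(1)[OF this x] have "\<forall>\<^sub>F n in sequentially. F (y n (\<kappa> n)) > S - e / 3" .
  moreover have "e / 3 > 0" using e by simp
  note close[OF this]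
  ultimately show "\<forall>\<^sub>F n in sequentially. dist (SUP k. b n k) (SUP x. F x) < e"
    unfolding S_def[symmetric]
  proof eventually_elim
    case (elim n)
    have le: "b n k \<le> S + e / 3" for k
      using elim(2)[rule_format, of k] F_le[of "y n k"] by linarith
    then have "(SUP k. b n k) \<le> S + e / 3" by (intro cSUP_least) auto
    moreover have "bdd_above (range (b n))" using le by (intro bdd_aboveI2)
    then have "b n (\<kappa> n) \<le> (SUP k. b n k)" by (intro cSUP_upper) auto
    then have "(SUP k. b n k) \<ge> S - 2 * e / 3"
      using elim(1) elim(2)[rule_format, of "\<kappa> n"] by linarith
    ultimately show ?case using e unfolding dist_real_def by linarith
  qed
qed

lemma rescaled_point_dense:
  fixes \<sigma> :: "'d::finite \<Rightarrow> real"
  assumes l: "filterlim l at_top sequentially" and \<sigma>: "\<And>j. \<sigma> j > 0"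
  shows "\<exists>\<kappa>. (\<lambda>n. rescaled_point m \<sigma> (l n) (\<kappa> n)) \<longlonglongrightarrow> x"
proof -
  \<comment> \<open>Invert the standardisation at \<open>x\<close> and round down; rounding costs at
    most one mesh width per coordinate.\<close>
  define \<kappa> :: "nat \<Rightarrow> int ^ 'd" where "\<kappa> = (\<lambda>n. \<chi> j. \<lfloor>l n * m j + x $ j * \<sigma> j * sqrt (l n)\<rfloor>)"
  have sq: "filterlim (\<lambda>n. sqrt (l n)) at_top sequentially"
    by (rule filterlim_compose[OF sqrt_at_top l])
  have pos: "\<forall>\<^sub>F n in sequentially. l n > 0" using l by (simp add: filterlim_at_top_dense)
  have "(\<lambda>n. rescaled_point m \<sigma> (l n) (\<kappa> n) $ j) \<longlonglongrightarrow> x $ j" for j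
  proof (subst LIM_zero_iff[symmetric], rule Lim_null_comparison)
    show "\<forall>\<^sub>F n in sequentially. norm (rescaled_point m \<sigma> (l n) (\<kappa> n) $ j - x $ j) \<le> (1 / \<sigma> j) / sqrt (l n)"
      using pos
    proof eventually_elim
      case (elim n)
      define u where "u = l n * m j + x $ j * \<sigma> j * sqrt (l n)"
      have den: "\<sigma> j * sqrt (l n) > 0" using elim \<sigma> by simp
      have "rescaled_point m \<sigma> (l n) (\<kappa> n) $ j - x $ j = (of_int \<lfloor>u\<rfloor> - u) / (\<sigma> j * sqrt (l n))"
      proof -
        have "x $ j = (u - l n * m j) / (\<sigma> j * sqrt (l n))"
          using elim \<sigma>[of j] by (simp add: u_def)
        moreover have "rescaled_point m \<sigma> (l n) (\<kappa> n) $ j = (of_int \<lfloor>u\<rfloor> - l n * m j) / (\<sigma> j * sqrt (l n))"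
          by (simp add: rescaled_point_def \<kappa>_def u_def)
        ultimately show ?thesis
          by (simp add: diff_divide_distrib)
      qed
      also have "norm \<dots> \<le> 1 / (\<sigma> j * sqrt (l n))"
      proof -
        have "\<bar>of_int \<lfloor>u\<rfloor> - u\<bar> \<le> 1" by linarith
        then show ?thesis using den by (simp add: abs_divide divide_right_mono)
      qed
      finally show ?case by simp
    qed
    show "(\<lambda>n. 1 / \<sigma> j / sqrt (l n)) \<longlonglongrightarrow> 0"
      by (rule tendsto_divide_0[OF tendsto_const filterlim_at_top_imp_at_infinity[OF sq]])
  qed
  then show ?thesis by (intro exI[of _ \<kappa>] vec_tendstoI)
qed

section \<open>The difference of the residues\<close>

lemma sqrt_power_eq_powr: "t > 0 \<Longrightarrow> sqrt t ^ s = t powr (real s / 2)"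
  by (simp add: powr_half_sqrt[symmetric] powr_powr flip: powr_realpow)

lemma wiener_algebra_continuous: "f \<in> wiener_algebra \<Longrightarrow> continuous_on UNIV f"
  for f :: "real ^ 'd::finite \<Rightarrow> complex"
  unfolding wiener_algebra_def using continuous_fourier_series by blast

lemma wiener_algebra_bounded: "f \<in> wiener_algebra \<Longrightarrow> \<exists>B. \<forall>\<xi>. norm (f \<xi>) \<le> B"
  for f :: "real ^ 'd::finite \<Rightarrow> complex"
  unfolding wiener_algebra_def using fourier_series_bounded by blast

text \<open>Both transforms carry the same factor \<open>E\<close>, so linearity leaves only the
  difference of the residues beside it.\<close>

lemma fourier_transform_inversion:
  fixes \<mu> \<mu>' :: "int ^ 'd::finite \<Rightarrow> real"
  assumes sum: "(\<lambda>k. \<bar>\<mu> k\<bar>) summable_on UNIV" "(\<lambda>k. \<bar>\<mu>' k\<bar>) summable_on UNIV"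
    and eq: "\<And>\<xi>. fourier_transform \<mu> \<xi> = E \<xi> * f \<xi>" "\<And>\<xi>. fourier_transform \<mu>' \<xi> = E \<xi> * f' \<xi>"
  shows "(2 * of_real pi) ^ CARD('d) * of_real (\<mu> k - \<mu>' k) =
      (\<integral>\<xi>. indicator torus_cube \<xi> *\<^sub>R (E \<xi> * (f \<xi> - f' \<xi>) * wave (- k) \<xi>) \<partial>lborel)"
proof -
  have I: "(2 * of_real pi) ^ CARD('d) * of_real (m k) = (\<integral>\<xi>. indicator torus_cube \<xi> *\<^sub>R (fourier_transform m \<xi> * wave (- k) \<xi>) \<partial>lborel)"
    "integrable lborel (\<lambda>\<xi>. indicator torus_cube \<xi> *\<^sub>R (fourier_transform m \<xi> * wave (- k) \<xi>))"
    if "(\<lambda>k. \<bar>m k\<bar>) summable_on UNIV" for m :: "int ^ 'd \<Rightarrow> real"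
  proof -
    have s: "(\<lambda>k. norm (complex_of_real (m k))) summable_on UNIV" using that by simp
    show "(2 * of_real pi) ^ CARD('d) * of_real (m k) = (\<integral>\<xi>. indicator torus_cube \<xi> *\<^sub>R (fourier_transform m \<xi> * wave (- k) \<xi>) \<partial>lborel)"
      unfolding fourier_transform_def by (rule fourier_inversion[OF s, symmetric])
    show "integrable lborel (\<lambda>\<xi>. indicator torus_cube \<xi> *\<^sub>R (fourier_transform m \<xi> * wave (- k) \<xi>))"
      unfolding fourier_transform_def
      by (intro integrable_torus_cube continuous_on_mult continuous_fourier_series[OF s] continuous_wave)
  qed
  have "(2 * of_real pi) ^ CARD('d) * of_real (\<mu> k - \<mu>' k) =
    (\<integral>\<xi>. indicator torus_cube \<xi> *\<^sub>R (fourier_transform \<mu> \<xi> * wave (- k) \<xi>)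
       - indicator torus_cube \<xi> *\<^sub>R (fourier_transform \<mu>' \<xi> * wave (- k) \<xi>) \<partial>lborel)"
    unfolding Bochner_Integration.integral_diff[OF I(2)[OF sum(1)] I(2)[OF sum(2)]]
      I(1)[OF sum(1), symmetric] I(1)[OF sum(2), symmetric]
    by (simp only: of_real_diff right_diff_distrib)
  also have "\<dots> = (\<integral>\<xi>. indicator torus_cube \<xi> *\<^sub>R (E \<xi> * (f \<xi> - f' \<xi>) * wave (- k) \<xi>) \<partial>lborel)"
    unfolding eq by (simp only: scaleR_diff_right[symmetric] left_diff_distrib right_diff_distrib mult.assoc)
  finally show ?thesis .
qed

lemma summable_law_mass:
  fixes X :: "'a \<Rightarrow> int ^ 'd::finite"
  assumes "prob_space M" "X \<in> measurable M (count_space UNIV)"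
  shows "(\<lambda>k. \<bar>law_mass M X k\<bar>) summable_on UNIV"
proof -
  interpret prob_space M by fact
  interpret D: prob_space "distr M (count_space UNIV) X"
    by (rule prob_space_distr) fact
  show ?thesis
  proof (rule nonneg_bdd_above_summable_on)
    show "bdd_above (sum (\<lambda>k. \<bar>law_mass M X k\<bar>) ` {F. F \<subseteq> UNIV \<and> finite F})"
    proof (intro bdd_aboveI2)
      fix F :: "(int ^ 'd) set" assume F: "F \<in> {F. F \<subseteq> UNIV \<and> finite F}"
      have "(\<Sum>k\<in>F. \<bar>law_mass M X k\<bar>) = measure (distr M (count_space UNIV) X) F"
        using F D.finite_measure_eq_sum_singleton[of F] by (simp add: law_mass_def)
      then show "(\<Sum>k\<in>F. \<bar>law_mass M X k\<bar>) \<le> 1" by simp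
    qed
  qed simp
qed

text \<open>A real supremum is meaningful for bounded families only; this allows a constant to be
  pulled out of \<open>local_distance\<close>.\<close>

lemma bdd_above_abs_diff_of_summable:
  fixes f g :: "'k \<Rightarrow> real"
  assumes "(\<lambda>k. \<bar>f k\<bar>) summable_on UNIV" "(\<lambda>k. \<bar>g k\<bar>) summable_on UNIV"
  shows "bdd_above (range (\<lambda>k. \<bar>f k - g k\<bar>))"
proof (rule bdd_aboveI2)
  have le: "\<bar>h k\<bar> \<le> (\<Sum>\<^sub>\<infinity>k. \<bar>h k\<bar>)" if "(\<lambda>k. \<bar>h k\<bar>) summable_on UNIV" for h :: "'k \<Rightarrow> real" and k
    using finite_sum_le_infsum[OF that, of "{k}"] by simp
  show "\<bar>f k - g k\<bar> \<le> (\<Sum>\<^sub>\<infinity>k. \<bar>f k\<bar>) + (\<Sum>\<^sub>\<infinity>k. \<bar>g k\<bar>)" for k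
    using le[OF assms(1), of k] le[OF assms(2), of k] by linarith
qed

lemma SUP_mult_left_real:
  fixes f :: "'k \<Rightarrow> real"
  assumes c: "c \<ge> 0" and bdd: "bdd_above (range f)"
  shows "(SUP k. c * f k) = c * (SUP k. f k)"
proof -
  have "c * (SUP k. f k) = (SUP s\<in>range f. c * s)"
    using c by (intro continuous_at_Sup_mono bdd) (auto intro!: monoI mult_left_mono continuous_intros)
  then show ?thesis by (simp add: image_image)
qed

text \<open>Near 0 the expansion gives the bound with coefficients uniform in \<open>n\<close>.
  Beyond radius \<open>d\<close> the bound \<open>B\<close> suffices, since there
  \<open>1 \<le> norm \<xi> ^ R / d ^ R\<close>.\<close>

lemma residue_difference_bound:
  fixes D :: "nat \<Rightarrow> real ^ 'd::finite \<Rightarrow> complex"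
  assumes cont: "\<And>n. continuous_on UNIV (D n)"
    and bdd: "\<forall>\<^sub>F n in sequentially. \<forall>\<xi>. norm (D n \<xi>) \<le> B"
    and exp: "\<forall>\<^sub>F \<xi> in at 0. \<forall>n. D n \<xi> = (\<Sum>\<alpha>\<in>multi_indices R. \<beta> n \<alpha> * imonom \<alpha> \<xi> * (1 + \<epsilon> n \<alpha> \<xi>))"
    and eps: "\<And>\<alpha>. \<alpha> \<in> multi_indices R \<Longrightarrow> uniform_limit UNIV (\<lambda>\<xi> n. \<epsilon> n \<alpha> \<xi>) (\<lambda>n. 0) (at 0)"
    and \<beta>: "\<And>\<alpha>. \<alpha> \<in> multi_indices R \<Longrightarrow> (\<lambda>n. \<beta> n \<alpha>) \<longlonglongrightarrow> \<beta>lim \<alpha>"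
  obtains C where "C \<ge> 0" "\<forall>\<^sub>F n in sequentially. \<forall>\<xi>. norm (D n \<xi>) \<le> C * norm \<xi> ^ R"
proof -
  \<comment> \<open>Convergent sequences are bounded, so one \<open>b \<alpha>\<close> serves every
    \<open>n\<close>.\<close>
  have "\<exists>b. \<forall>\<alpha>\<in>multi_indices R. \<forall>n. norm (\<beta> n \<alpha>) \<le> b \<alpha>"
    by (rule bchoice) (metis \<beta> convergentI convergent_imp_Bseq Bseq_def)
  then obtain b where b: "\<And>\<alpha> n. \<alpha> \<in> multi_indices R \<Longrightarrow> norm (\<beta> n \<alpha>) \<le> b \<alpha>" by blast
  \<comment> \<open>The factor 2 bounds \<open>1 + \<epsilon> n \<alpha> \<xi>\<close> once the
    error term has norm below 1.\<close>
  define C where "C = (\<Sum>\<alpha>\<in>(multi_indices R :: (nat ^ 'd) set). b \<alpha> * 2)"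
  have b0: "b \<alpha> \<ge> 0" if "\<alpha> \<in> multi_indices R" for \<alpha>
    using b[OF that, of 0] norm_ge_zero order_trans by blast
  have C0: "C \<ge> 0" unfolding C_def by (intro sum_nonneg) (use b0 in auto)
  have "\<forall>\<^sub>F \<xi> in at 0. \<forall>\<alpha>\<in>multi_indices R. \<forall>n\<in>UNIV. dist (\<epsilon> n \<alpha> \<xi>) 0 < 1"
    by (intro eventually_ball_finite finite_multi_indices ballI uniform_limitD[OF eps]) auto
  with exp have near: "\<forall>\<^sub>F \<xi> in at 0. \<forall>n. norm (D n \<xi>) \<le> C * norm \<xi> ^ R"
  proof eventually_elim
    case (elim \<xi>)
    show ?case
    proof
      fix n
      have "norm (D n \<xi>) \<le> (\<Sum>\<alpha>\<in>multi_indices R. norm (\<beta> n \<alpha> * imonom \<alpha> \<xi> * (1 + \<epsilon> n \<alpha> \<xi>)))"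
        unfolding elim(1)[rule_format] by (rule norm_sum)
      also have "\<dots> \<le> (\<Sum>\<alpha>\<in>multi_indices R. b \<alpha> * norm \<xi> ^ R * 2)"
      proof (rule sum_mono)
        fix \<alpha> :: "nat ^ 'd" assume \<alpha>: "\<alpha> \<in> multi_indices R"
        have "norm (1 + \<epsilon> n \<alpha> \<xi>) \<le> 2"
        proof -
          have "norm (\<epsilon> n \<alpha> \<xi>) < 1" using elim(2) \<alpha> by simp
          then show ?thesis using norm_triangle_ineq[of 1 "\<epsilon> n \<alpha> \<xi>"] by simp
        qed
        then show "norm (\<beta> n \<alpha> * imonom \<alpha> \<xi> * (1 + \<epsilon> n \<alpha> \<xi>)) \<le> b \<alpha> * norm \<xi> ^ R * 2"
          unfolding norm_mult using b[OF \<alpha>] norm_imonom_le[OF \<alpha>] b0[OF \<alpha>]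
          by (intro mult_mono) auto
      qed
      also have "\<dots> = C * norm \<xi> ^ R"
        unfolding C_def sum_distrib_right by (intro sum.cong) auto
      finally show "norm (D n \<xi>) \<le> C * norm \<xi> ^ R" .
    qed
  qed
  then obtain d where d: "d > 0" "\<And>\<xi> n. \<xi> \<noteq> 0 \<Longrightarrow> norm \<xi> < d \<Longrightarrow> norm (D n \<xi>) \<le> C * norm \<xi> ^ R"
    unfolding eventually_at by (auto simp: dist_norm)
  \<comment> \<open>The filter \<open>at 0\<close> says nothing about 0 itself; continuity extends
    the inequality there.\<close>
  have at_0: "norm (D n 0) \<le> C * norm (0 :: real ^ 'd) ^ R" for n
  proof (rule tendsto_le[where F="at (0 :: real ^ 'd)"])
    show "\<forall>\<^sub>F \<xi> in at 0. norm (D n \<xi>) \<le> C * norm \<xi> ^ R"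
      using near by eventually_elim blast
    have "((\<lambda>\<xi>. D n \<xi>) \<longlongrightarrow> D n 0) (at 0)"
      using cont[of n] by (simp add: continuous_on_eq_continuous_at isCont_def)
    then show "((\<lambda>\<xi>. norm (D n \<xi>)) \<longlongrightarrow> norm (D n 0)) (at 0)"
      by (rule tendsto_norm)
    show "((\<lambda>\<xi> :: real ^ 'd. C * norm \<xi> ^ R) \<longlongrightarrow> C * norm (0 :: real ^ 'd) ^ R) (at 0)"
      by (intro tendsto_intros)
  qed simp
  show thesis
  proof
    \<comment> \<open>Keeps the constant nonnegative whatever the sign of \<open>B\<close>.\<close>
    define B' where "B' = max B 0"
    show "C + B' / d ^ R \<ge> 0" using C0 d(1) by (simp add: B'_def)
    show "\<forall>\<^sub>F n in sequentially. \<forall>\<xi>. norm (D n \<xi>) \<le> (C + B' / d ^ R) * norm \<xi> ^ R"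
      using bdd
    proof eventually_elim
      case (elim n)
      show ?case
      proof
        fix \<xi> :: "real ^ 'd"
        have nn: "B' / d ^ R * norm \<xi> ^ R \<ge> 0" "C * norm \<xi> ^ R \<ge> 0" using C0 d(1) by (auto simp: B'_def)
        consider "\<xi> = 0" | "\<xi> \<noteq> 0" "norm \<xi> < d" | "norm \<xi> \<ge> d" by linarith
        then have "norm (D n \<xi>) \<le> C * norm \<xi> ^ R \<or> norm (D n \<xi>) \<le> B' / d ^ R * norm \<xi> ^ R"
        proof cases
          case 3
          have "norm (D n \<xi>) \<le> B' / d ^ R * d ^ R" using elim[rule_format, of \<xi>] d(1) by (simp add: B'_def)
          also have "\<dots> \<le> B' / d ^ R * norm \<xi> ^ R"
            using 3 d(1) by (intro mult_left_mono power_mono) (auto simp: B'_def)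
          finally show ?thesis ..
        qed (use at_0 d in auto)
        then show "norm (D n \<xi>) \<le> (C + B' / d ^ R) * norm \<xi> ^ R"
          unfolding distrib_right using nn by linarith
      qed
    qed
  qed
qed

text \<open>The leading terms are homogeneous of degree \<open>R\<close>, so
  \<open>sqrt (l n) ^ R\<close> cancels their scaling and the coefficients pass to the
  limit.\<close>

lemma residue_difference_tendsto:
  fixes D :: "nat \<Rightarrow> real ^ 'd::finite \<Rightarrow> complex"
  assumes l: "filterlim l at_top sequentially" and v: "v \<noteq> 0"
    and exp: "\<forall>\<^sub>F \<xi> in at 0. \<forall>n. D n \<xi> = (\<Sum>\<alpha>\<in>multi_indices R. \<beta> n \<alpha> * imonom \<alpha> \<xi> * (1 + \<epsilon> n \<alpha> \<xi>))"
    and eps: "\<And>\<alpha>. \<alpha> \<in> multi_indices R \<Longrightarrow> uniform_limit UNIV (\<lambda>\<xi> n. \<epsilon> n \<alpha> \<xi>) (\<lambda>n. 0) (at 0)"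
    and \<beta>: "\<And>\<alpha>. \<alpha> \<in> multi_indices R \<Longrightarrow> (\<lambda>n. \<beta> n \<alpha>) \<longlonglongrightarrow> \<beta>lim \<alpha>"
  shows "(\<lambda>n. of_real (sqrt (l n) ^ R) * D n ((1 / sqrt (l n)) *\<^sub>R v)) \<longlonglongrightarrow> (\<Sum>\<alpha>\<in>multi_indices R. \<beta>lim \<alpha> * imonom \<alpha> v)"
proof -
  define \<xi> where "\<xi> = (\<lambda>n. (1 / sqrt (l n)) *\<^sub>R v)"
  have pos: "\<forall>\<^sub>F n in sequentially. l n > 0" using l by (simp add: filterlim_at_top_dense)
  have sq: "filterlim (\<lambda>n. sqrt (l n)) at_top sequentially"
    by (rule filterlim_compose[OF sqrt_at_top l])
  have \<xi>: "filterlim \<xi> (at 0) sequentially"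
    unfolding filterlim_at
  proof
    have "(\<lambda>n. 1 / sqrt (l n)) \<longlonglongrightarrow> 0"
      by (rule tendsto_divide_0[OF tendsto_const filterlim_at_top_imp_at_infinity[OF sq]])
    from tendsto_scaleR[OF this tendsto_const[of v]] show "\<xi> \<longlonglongrightarrow> 0" by (simp add: \<xi>_def)
    show "\<forall>\<^sub>F n in sequentially. \<xi> n \<in> UNIV \<and> \<xi> n \<noteq> 0"
      using pos by eventually_elim (use v in \<open>auto simp: \<xi>_def\<close>)
  qed
  \<comment> \<open>Index and argument move together here, which is where uniformity in
    \<open>n\<close> of the error terms enters.\<close>
  have "(\<lambda>n. \<epsilon> n \<alpha> (\<xi> n)) \<longlonglongrightarrow> 0" if "\<alpha> \<in> multi_indices R" for \<alpha>
  proof (rule tendstoI)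
    fix e :: real assume "e > 0"
    from eventually_compose_filterlim[OF uniform_limitD[OF eps[OF that] this] \<xi>]
    show "\<forall>\<^sub>F n in sequentially. dist (\<epsilon> n \<alpha> (\<xi> n)) 0 < e"
      by eventually_elim simp
  qed
  then have "(\<lambda>n. \<Sum>\<alpha>\<in>multi_indices R. \<beta> n \<alpha> * imonom \<alpha> v * (1 + \<epsilon> n \<alpha> (\<xi> n)))
     \<longlonglongrightarrow> (\<Sum>\<alpha>\<in>multi_indices R. \<beta>lim \<alpha> * imonom \<alpha> v * (1 + 0))"
    by (intro tendsto_sum tendsto_mult tendsto_add tendsto_const \<beta>)
  moreover have "\<forall>\<^sub>F n in sequentially. (\<Sum>\<alpha>\<in>multi_indices R. \<beta> n \<alpha> * imonom \<alpha> v * (1 + \<epsilon> n \<alpha> (\<xi> n)))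
     = of_real (sqrt (l n) ^ R) * D n (\<xi> n)"
    using pos eventually_compose_filterlim[OF exp \<xi>]
  proof eventually_elim
    case (elim n)
    have "of_real (sqrt (l n) ^ R) * imonom \<alpha> (\<xi> n) = imonom \<alpha> v" if "\<alpha> \<in> multi_indices R" for \<alpha>
    proof -
      have "complex_of_real (sqrt (l n) ^ R) * of_real ((1 / sqrt (l n)) ^ R) = 1"
        using elim(1) by (simp flip: of_real_mult power_mult_distrib)
      then show ?thesis
        unfolding \<xi>_def imonom_scaleR[OF that] mult.assoc[symmetric] by simp
    qed
    then show ?case
      unfolding elim(2)[rule_format] sum_distrib_left
      by (intro sum.cong refl) (simp add: mult_ac)
  qed
  ultimately show ?thesis
    unfolding \<xi>_def by (simp add: Lim_transform_eventually)
qed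

section \<open>The local distance\<close>

theorem theorem5p8:
  fixes p :: "'d::finite \<Rightarrow> int pmf"
    and \<phi> :: "'d \<Rightarrow> real \<Rightarrow> complex"
    and m \<sigma> :: "'d \<Rightarrow> real"
    and M :: "nat \<Rightarrow> 'a measure"
    and X :: "nat \<Rightarrow> 'a \<Rightarrow> int ^ 'd"
    and \<nu> :: "nat \<Rightarrow> int ^ 'd \<Rightarrow> real"
    and l :: "nat \<Rightarrow> real"
    and \<psi> chi :: "nat \<Rightarrow> real ^ 'd \<Rightarrow> complex"
    and \<psi>lim chilim :: "real ^ 'd \<Rightarrow> complex"
    and r :: nat
    and \<beta> :: "nat \<Rightarrow> nat ^ 'd \<Rightarrow> complex"
    and \<beta>lim :: "nat ^ 'd \<Rightarrow> complex"
    and \<epsilon> :: "nat \<Rightarrow> nat ^ 'd \<Rightarrow> real ^ 'd \<Rightarrow> complex"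
    and \<epsilon>lim :: "nat ^ 'd \<Rightarrow> real ^ 'd \<Rightarrow> complex"
  assumes "CARD('d) \<ge> 2"
    and "\<And>j. reference_exponent (p j) (\<phi> j) (m j) (\<sigma> j)"
    and "\<And>n. prob_space (M n)"
    and "\<And>n. X n \<in> measurable (M n) (count_space UNIV)"
    and "mod_phi_convergent (total_exponent \<phi>) l M X \<psi> \<psi>lim"
    and "approximation_scheme (total_exponent \<phi>) l \<nu> chi chilim"
    and "\<forall>\<^sub>F \<xi> in at 0. \<forall>n. \<psi> n \<xi> - chi n \<xi> =
           (\<Sum>\<alpha>\<in>multi_indices (r + 1). \<beta> n \<alpha> * imonom \<alpha> \<xi> * (1 + \<epsilon> n \<alpha> \<xi>))"
    and "\<And>\<alpha>. \<alpha> \<in> multi_indices (r + 1) \<Longrightarrow>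
           uniform_limit UNIV (\<lambda>\<xi> n. \<epsilon> n \<alpha> \<xi>) (\<lambda>n. 0) (at 0)"
    and "\<forall>\<^sub>F \<xi> in at 0. \<psi>lim \<xi> - chilim \<xi> =
           (\<Sum>\<alpha>\<in>multi_indices (r + 1). \<beta>lim \<alpha> * imonom \<alpha> \<xi> * (1 + \<epsilon>lim \<alpha> \<xi>))"
    and "\<And>\<alpha>. \<alpha> \<in> multi_indices (r + 1) \<Longrightarrow> (\<epsilon>lim \<alpha> \<longlongrightarrow> 0) (at 0)"
    and "\<And>\<alpha>. \<alpha> \<in> multi_indices (r + 1) \<Longrightarrow> (\<lambda>n. \<beta> n \<alpha>) \<longlonglongrightarrow> \<beta>lim \<alpha>"
  shows "(\<lambda>n. local_distance (law_mass (M n) (X n)) (\<nu> n)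
            - (SUP x::real ^ 'd. exp (- ((norm x)\<^sup>2 / 2)) *
                 norm (\<Sum>\<alpha>\<in>multi_indices (r + 1).
                   \<beta>lim \<alpha> * of_real (multi_hermite \<alpha> x) / of_real (\<Prod>i\<in>UNIV. \<sigma> i ^ (\<alpha> $ i))))
              * (1 / ((\<Prod>i\<in>UNIV. sqrt (2 * pi) * \<sigma> i) * l n powr (real (r + CARD('d) + 1) / 2))))
         \<in> o(\<lambda>n. 1 / l n powr (real (r + CARD('d) + 1) / 2))"
proof -
  define R where "R = r + 1"
  define a where "a = (\<lambda>n k. law_mass (M n) (X n) k - \<nu> n k)"
  define D where "D = (\<lambda>n \<xi>. \<psi> n \<xi> - chi n \<xi>)"
  define P where "P = (\<Prod>i\<in>UNIV. sqrt (2 * pi) * \<sigma> i)"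
  define S where "S = (SUP y. norm (hermite_profile \<sigma> R \<beta>lim y))"
  \<comment> \<open>A natural power of the square root, as in the scaling lemmas; it is identified
    with the real power of \<open>l n\<close> where \<open>l n > 0\<close>, using
    \<open>R = r + 1\<close>.\<close>
  define q where "q = (\<lambda>n. sqrt (l n) ^ (R + CARD('d)))"
  note ref = assms(2)
  have \<sigma>: "\<sigma> j > 0" for j using ref[of j] by (simp add: reference_exponent_def)
  have P: "P > 0" unfolding P_def using \<sigma> by (intro prod_pos) simp
  have res: "has_residues (total_exponent \<phi>) l (\<lambda>n. law_mass (M n) (X n)) \<psi> \<psi>lim"
    "has_residues (total_exponent \<phi>) l \<nu> chi chilim"
    and sum_\<nu>: "\<And>n. (\<lambda>k. \<bar>\<nu> n k\<bar>) summable_on UNIV"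
    using assms(5,6) unfolding mod_phi_convergent_def approximation_scheme_def by auto
  have sum_\<mu>: "(\<lambda>k. \<bar>law_mass (M n) (X n) k\<bar>) summable_on UNIV" for n
    by (rule summable_law_mass[OF assms(3,4)])
  have l: "filterlim l at_top sequentially" using res(1) by (simp add: has_residues_def)
  have pos: "\<forall>\<^sub>F n in sequentially. l n > 0" using l by (simp add: filterlim_at_top_dense)
  have wiener: "\<psi> n \<in> wiener_algebra" "chi n \<in> wiener_algebra" "\<psi>lim \<in> wiener_algebra" "chilim \<in> wiener_algebra" for n
    using res by (auto simp: has_residues_def)
  have cont: "continuous_on UNIV (D n)" for n
    unfolding D_def by (intro continuous_intros wiener_algebra_continuous wiener)
  obtain B where B: "\<forall>\<^sub>F n in sequentially. \<forall>\<xi>. norm (D n \<xi>) \<le> B"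
  proof -
    obtain B1 B2 where b: "\<And>\<xi>. norm (\<psi>lim \<xi>) \<le> B1" "\<And>\<xi>. norm (chilim \<xi>) \<le> B2"
      using wiener_algebra_bounded[OF wiener(3)] wiener_algebra_bounded[OF wiener(4)] by blast
    have lim: "uniform_limit UNIV \<psi> \<psi>lim sequentially" "uniform_limit UNIV chi chilim sequentially"
      using res by (auto simp: has_residues_def)
    \<comment> \<open>The 2 is one unit of distance for each of the two uniform limits.\<close>
    from uniform_limitD[OF lim(1) zero_less_one] uniform_limitD[OF lim(2) zero_less_one] have "\<forall>\<^sub>F n in sequentially. \<forall>\<xi>. norm (D n \<xi>) \<le> B1 + B2 + 2"
    proof eventually_elim
      case (elim n)
      show ?case
      proof
        fix \<xi>
        have "norm (D n \<xi>) \<le> norm (\<psi> n \<xi>) + norm (chi n \<xi>)"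
          unfolding D_def by (rule norm_triangle_ineq4)
        moreover have "norm (\<psi> n \<xi>) \<le> norm (\<psi>lim \<xi>) + 1" "norm (chi n \<xi>) \<le> norm (chilim \<xi>) + 1"
          using elim(1)[rule_format, of \<xi>] elim(2)[rule_format, of \<xi>]
            norm_triangle_ineq2[of "\<psi> n \<xi>" "\<psi>lim \<xi>"] norm_triangle_ineq2[of "chi n \<xi>" "chilim \<xi>"]
          by (auto simp: dist_norm)
        ultimately show "norm (D n \<xi>) \<le> B1 + B2 + 2" using b[of \<xi>] by linarith
      qed
    qed
    then show ?thesis by (rule that)
  qed
  have expansion: "\<forall>\<^sub>F \<xi> in at 0. \<forall>n. D n \<xi> = (\<Sum>\<alpha>\<in>multi_indices R. \<beta> n \<alpha> * imonom \<alpha> \<xi> * (1 + \<epsilon> n \<alpha> \<xi>))"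
    using assms(7) unfolding D_def R_def .
  note eps = assms(8)[folded R_def] and beta = assms(11)[folded R_def]
  obtain C where C: "C \<ge> 0" "\<forall>\<^sub>F n in sequentially. \<forall>\<xi>. norm (D n \<xi>) \<le> C * norm \<xi> ^ R"
    by (rule residue_difference_bound[OF cont B expansion]) (rule eps beta that; assumption)+
  have C_cube: "\<forall>\<^sub>F n in sequentially. \<forall>\<xi>\<in>torus_cube. norm (D n \<xi>) \<le> C * norm \<xi> ^ R"
    using C(2) by eventually_elim blast
  have inversion: "(2 * of_real pi) ^ CARD('d) * of_real (a n k) =
      (\<integral>\<xi>. indicator torus_cube \<xi> *\<^sub>R (exp (of_real (l n) * total_exponent \<phi> \<xi>) * D n \<xi> * wave (- k) \<xi>) \<partial>lborel)" for n k
    unfolding a_def D_def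
    by (rule fourier_transform_inversion[OF sum_\<mu> sum_\<nu>])
      (rule res[unfolded has_residues_def, THEN conjunct2, THEN conjunct1, rule_format])+
  have close: "\<forall>\<^sub>F n in sequentially. \<forall>k. \<bar>P * q n * \<bar>a n k\<bar> - norm (hermite_profile \<sigma> R \<beta>lim (rescaled_point m \<sigma> (l n) k))\<bar> \<le> e"
    if "e > 0" for e
  proof -
    have "\<forall>\<^sub>F n in sequentially. \<forall>k. norm (of_real ((\<Prod>i\<in>UNIV. sqrt (2 * pi) * \<sigma> i) * sqrt (l n) ^ (R + CARD('d)) * a n k)
      - hermite_profile \<sigma> R \<beta>lim (rescaled_point m \<sigma> (l n) k)) \<le> e"
      by (rule local_limit_uniform[where p=p, OF ref l cont _ C(1) C_cube inversion that])
        (rule residue_difference_tendsto[OF l _ expansion eps beta])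
    with pos show ?thesis
    proof eventually_elim
      case (elim n)
      have "q n \<ge> 0" unfolding q_def using elim(1) by simp
      then have norm_eq: "norm (complex_of_real (P * q n * a n k)) = P * q n * \<bar>a n k\<bar>" for k
        unfolding norm_of_real using P by (simp add: abs_mult)
      show ?case
      proof
        fix k
        have "norm (complex_of_real (P * q n * a n k) - hermite_profile \<sigma> R \<beta>lim (rescaled_point m \<sigma> (l n) k)) \<le> e"
          using elim(2) unfolding P_def q_def by blast
        \<comment> \<open>Reverse triangle inequality: the complex estimate passes to absolute
          values with the same error.\<close>
        from order_trans[OF norm_triangle_ineq3 this]
        show "\<bar>P * q n * \<bar>a n k\<bar> - norm (hermite_profile \<sigma> R \<beta>lim (rescaled_point m \<sigma> (l n) k))\<bar> \<le> e"
          unfolding norm_eq .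
      qed
    qed
  qed
  have "(\<lambda>n. SUP k. P * q n * \<bar>a n k\<bar>) \<longlonglongrightarrow> S"
    unfolding S_def
  proof (rule SUP_tendsto_of_uniform)
    show "continuous_on UNIV (\<lambda>y. norm (hermite_profile \<sigma> R \<beta>lim y))"
      by (intro continuous_on_norm continuous_hermite_profile)
    show "bdd_above (range (\<lambda>y. norm (hermite_profile \<sigma> R \<beta>lim y)))"
      using hermite_profile_bounded[of \<sigma> R \<beta>lim] by (auto intro: bdd_aboveI2)
    show "\<exists>\<kappa>. (\<lambda>n. rescaled_point m \<sigma> (l n) (\<kappa> n)) \<longlonglongrightarrow> x" for x
      by (rule rescaled_point_dense[OF l \<sigma>])
  qed (rule close)
  moreover have "\<forall>\<^sub>F n in sequentially. (SUP k. P * q n * \<bar>a n k\<bar>) = P * q n * local_distance (law_mass (M n) (X n)) (\<nu> n)"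
    using pos
  proof eventually_elim
    case (elim n)
    show ?case
      unfolding local_distance_def a_def
      by (rule SUP_mult_left_real[OF _ bdd_above_abs_diff_of_summable[OF sum_\<mu> sum_\<nu>]])
        (use P elim in \<open>simp add: q_def\<close>)
  qed
  ultimately have lim: "(\<lambda>n. P * q n * local_distance (law_mass (M n) (X n)) (\<nu> n)) \<longlonglongrightarrow> S"
    by (rule Lim_transform_eventually)
  have q: "\<forall>\<^sub>F n in sequentially. l n powr (real (r + CARD('d) + 1) / 2) = q n \<and> q n > 0"
    using pos
  proof eventually_elim
    case (elim n)
    have "r + CARD('d) + 1 = R + CARD('d)" by (simp add: R_def)
    then have "l n powr (real (r + CARD('d) + 1) / 2) = q n"
      unfolding q_def sqrt_power_eq_powr[OF elim] by (simp only:)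
    moreover have "q n > 0" using elim by (simp add: q_def)
    ultimately show ?case ..
  qed
  have S: "(SUP x::real ^ 'd. exp (- ((norm x)\<^sup>2 / 2)) *
       norm (\<Sum>\<alpha>\<in>multi_indices (r + 1).
         \<beta>lim \<alpha> * of_real (multi_hermite \<alpha> x) / of_real (\<Prod>i\<in>UNIV. \<sigma> i ^ (\<alpha> $ i)))) = S"
    unfolding S_def hermite_profile_def R_def norm_mult norm_of_real abs_exp_cancel ..
  show ?thesis
    unfolding S P_def[symmetric]
  proof (rule smalloI_tendsto)
    \<comment> \<open>Dividing by \<open>P\<close> gives the quotient that little-o asks for, at
      every \<open>n\<close> with \<open>q n > 0\<close>.\<close>
    have "(\<lambda>n. (P * q n * local_distance (law_mass (M n) (X n)) (\<nu> n) - S) / P) \<longlonglongrightarrow> (S - S) / P"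
      using P by (intro tendsto_intros lim) auto
    then have "(\<lambda>n. (P * q n * local_distance (law_mass (M n) (X n)) (\<nu> n) - S) / P) \<longlonglongrightarrow> 0"
      by simp
    then show "(\<lambda>n. (local_distance (law_mass (M n) (X n)) (\<nu> n) -
          S * (1 / (P * l n powr (real (r + CARD('d) + 1) / 2)))) /
        (1 / l n powr (real (r + CARD('d) + 1) / 2))) \<longlonglongrightarrow> 0"
    proof (rule Lim_transform_eventually)
      show "\<forall>\<^sub>F n in sequentially. (P * q n * local_distance (law_mass (M n) (X n)) (\<nu> n) - S) / P =
        (local_distance (law_mass (M n) (X n)) (\<nu> n) -
          S * (1 / (P * l n powr (real (r + CARD('d) + 1) / 2)))) /
        (1 / l n powr (real (r + CARD('d) + 1) / 2))"
        using q
      proof eventually_elim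
        case (elim n)
        then have "l n powr (real (r + CARD('d) + 1) / 2) = q n" "q n > 0" by blast+
        then show ?case using P by (simp only:) (simp add: field_simps)
      qed
    qed
    show "\<forall>\<^sub>F n in sequentially. 1 / l n powr (real (r + CARD('d) + 1) / 2) \<noteq> 0"
      using q by eventually_elim simp
  qed
qed

end
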